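(* Let $k:\mathbb{T}\to\mathbb{T}$ be a homeomorphism for which there exists a solution of the welding equation, i.e. a pair of Blaschke products $A,B$ of the same degree with $A\circ k=B$ on $\mathbb{T}$. Let $d$ be the minimal degree of such a solution and let $A,B$ be a solution of degree $d$. Then every other solution of degree $d$ is of the form $M\circ A$, $M\circ B$ for some $M\in\text{Möb}_{\mathbb{D}}$.
   Context: $\mathbb{D}=\{z:|z|<1\}$ and $\mathbb{T}=\{z:|z|=1\}$. A Blaschke product is a rational map of degree $\geq 1$ whose restriction to $\mathbb{D}$ is a proper map onto $\mathbb{D}$. The degree of a solution $A,B$ is the common degree $\deg A=\deg B$. $\text{Möb}_{\mathbb{D}}$ denotes the group of Möbius transformations $M$ with $M(\mathbb{D})=\mathbb{D}$. *)

theory Defs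
  imports
    "HOL-Analysis.Analysis"
    "HOL-Computational_Algebra.Computational_Algebra"
    "HOL-Computational_Algebra.Field_as_Ring"
begin

text \<open>The Riemann sphere is the one-point compactification of the complex plane;
  \<^term>\<open>None\<close> is the point at infinity.\<close>

type_synonym rsphere = "complex option"

definition riemann_sphere :: "rsphere topology" where
  "riemann_sphere = Alexandroff_compactification euclidean"

definition disc :: "rsphere set" where
  "disc = Some ` ball 0 1"

text \<open>The self-map \<open>p / q\<close> of the sphere. It is the map \<open>[z : w] \<mapsto> [P(z,w) : Q(z,w)]\<close>, where
  \<open>P\<close> and \<open>Q\<close> are the homogenizations of \<open>p\<close> and \<open>q\<close> to the common degree
  \<open>max (degree p) (degree q)\<close>; hence the value at infinity. It is meaningful only for
  coprime \<open>p\<close> and \<open>q\<close>; every use below has coprime arguments.\<close>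

definition rat_map :: "complex poly \<Rightarrow> complex poly \<Rightarrow> rsphere \<Rightarrow> rsphere" where
  "rat_map p q x =
    (let n = max (degree p) (degree q);
         (u, v) = (case x of Some z \<Rightarrow> (poly p z, poly q z) | None \<Rightarrow> (coeff p n, coeff q n))
     in if v = 0 then None else Some (u / v))"

definition rational_map :: "(rsphere \<Rightarrow> rsphere) \<Rightarrow> bool" where
  "rational_map f \<longleftrightarrow> (\<exists>p q. coprime p q \<and> f = rat_map p q)"

definition rat_degree :: "(rsphere \<Rightarrow> rsphere) \<Rightarrow> nat" where
  "rat_degree f = (THE n. \<exists>p q. coprime p q \<and> f = rat_map p q \<and> n = max (degree p) (degree q))"

lemma rat_map_eq_imp_cross:
  assumes "rat_map p q = rat_map p' q'"
  shows "p * q' = p' * q"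
proof -
  have "poly (p * q') z = poly (p' * q) z" for z
    using fun_cong[OF assms, of "Some z"]
    by (auto simp: rat_map_def field_simps split: if_splits)
  then show ?thesis
    by (simp add: poly_eq_poly_eq_iff[symmetric] fun_eq_iff)
qed

lemma rat_degree_rat_map:
  assumes "coprime p q"
  shows "rat_degree (rat_map p q) = max (degree p) (degree q)"
proof -
  have le: "degree p \<le> degree p' \<and> degree q \<le> degree q'"
    if "coprime p q" "coprime p' q'" and cross: "p * q' = p' * q"
    for p q p' q' :: "complex poly"
  proof -
    have "p dvd p' * q" "q dvd q' * p"
      by (metis cross dvd_triv_left, metis cross dvd_triv_right mult.commute)
    then have dvd: "p dvd p'" "q dvd q'"
      using that by (auto simp: coprime_dvd_mult_left_iff coprime_commute)
    have "p' * q' \<noteq> 0 \<or> is_unit p' \<or> is_unit q'"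
      using that(2) by auto
    moreover have "p' = 0 \<Longrightarrow> p = 0" "q' = 0 \<Longrightarrow> q = 0"
      using cross that by auto
    ultimately show ?thesis
      using dvd by (auto intro: dvd_imp_degree_le simp: is_unit_iff_degree)
  qed
  show ?thesis
    unfolding rat_degree_def
  proof (rule the_equality)
    fix n
    assume "\<exists>p' q'. coprime p' q' \<and> rat_map p q = rat_map p' q' \<and> n = max (degree p') (degree q')"
    then obtain p' q' where *: "coprime p' q'" "rat_map p q = rat_map p' q'"
        "n = max (degree p') (degree q')"
      by blast
    then show "n = max (degree p) (degree q)"
      using le[OF assms *(1)] le[OF *(1) assms] rat_map_eq_imp_cross[OF *(2)] by fastforce
  qed (use assms in blast)
qed

definition blaschke_product :: "(rsphere \<Rightarrow> rsphere) \<Rightarrow> bool" where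
  "blaschke_product A \<longleftrightarrow>
     rational_map A \<and> rat_degree A \<ge> 1 \<and> A ` disc = disc \<and>
     proper_map (subtopology riemann_sphere disc) (subtopology riemann_sphere disc) A"

text \<open>The values of \<open>k\<close> off the unit circle are irrelevant.\<close>

definition welding_solution ::
  "(complex \<Rightarrow> complex) \<Rightarrow> (rsphere \<Rightarrow> rsphere) \<Rightarrow> (rsphere \<Rightarrow> rsphere) \<Rightarrow> bool" where
  "welding_solution k A B \<longleftrightarrow>
     blaschke_product A \<and> blaschke_product B \<and> rat_degree A = rat_degree B \<and>
     (\<forall>z\<in>sphere 0 1. A (Some (k z)) = B (Some z))"

definition moebius_disc :: "(rsphere \<Rightarrow> rsphere) set" where
  "moebius_disc =
     {M. (\<exists>a b c d. a * d - b * c \<noteq> 0 \<and> M = rat_map [:b, a:] [:d, c:]) \<and> M ` disc = disc}"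

end

theory Submission
  imports Defs
begin

text \<open>
  Call a rational function \<open>F\<close> weldable if \<open>F \<circ> k\<close> agrees on the circle with a rational function.
  The weldable functions form an intermediate field of \<open>\<complex>(z)/\<complex>\<close> that is closed under
  \<open>F(z) \<mapsto> cnj (F(1 / cnj z))\<close>, so by Lueroth's theorem it is generated by any nonconstant
  element \<open>u\<close> of minimal degree \<open>N\<close>. The fibres of \<open>u\<close> lie in fibres of the Blaschke product \<open>A\<close>;
  hence the Moebius image of \<open>u\<close> with a zero at a generic point of the disc has all its zeros in the
  disc, and dividing by its reflection gives a generator \<open>h\<close> that is itself a Blaschke product.
  Now \<open>A = f \<circ> h\<close> forces \<open>B = f \<circ> g\<close> for \<open>g = h \<circ> k\<close>, and since \<open>f\<close> is a Blaschke product, so is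
  \<open>g\<close>, of the same degree as \<open>h\<close>. Thus \<open>(h, g)\<close> is a solution of degree \<open>N\<close>; minimality of \<open>d\<close> gives
  \<open>N = d\<close>, and every solution of degree \<open>d\<close> is a Moebius image of \<open>(h, g)\<close>.
\<close>

section \<open>Polynomials over an intermediate field of the rational functions\<close>

text \<open>An intermediate field of C(z)/C, kept as a subset of the fraction field of C[z]. Since
  \<open>inverse 0 = 0\<close>, closure under inverses is stated without excluding zero.\<close>

locale function_field =
  fixes K :: "complex poly fract set"
  assumes const_mem: "to_fract [:c:] \<in> K"
    and add_mem: "x \<in> K \<Longrightarrow> y \<in> K \<Longrightarrow> x + y \<in> K"
    and mult_mem: "x \<in> K \<Longrightarrow> y \<in> K \<Longrightarrow> x * y \<in> K"
    and inverse_mem: "x \<in> K \<Longrightarrow> inverse x \<in> K"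
begin

lemma zero_mem: "0 \<in> K"
  using const_mem[of 0] by simp

lemma diff_mem: "x \<in> K \<Longrightarrow> y \<in> K \<Longrightarrow> x - y \<in> K"
proof -
  assume "x \<in> K" "y \<in> K"
  then have "x + to_fract [:-1:] * y \<in> K"
    by (intro add_mem mult_mem const_mem)
  moreover have "to_fract [:-1::complex:] = -1"
    by (metis minus_pCons one_pCons pCons_0_0 minus_zero to_fract_1 to_fract_uminus)
  ultimately show ?thesis by simp
qed

lemma divide_mem: "x \<in> K \<Longrightarrow> y \<in> K \<Longrightarrow> x / y \<in> K"
  by (simp add: divide_inverse inverse_mem mult_mem)

text \<open>The field \<open>K\<close> is a set and not a type, so its polynomials are singled out
  inside the polynomials over all rational functions.\<close>

definition over :: "complex poly fract poly \<Rightarrow> bool" where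
  "over P \<longleftrightarrow> (\<forall>i. coeff P i \<in> K)"

lemma over_diff: "over P \<Longrightarrow> over Q \<Longrightarrow> over (P - Q)"
  by (simp add: over_def diff_mem)

lemma over_smult: "x \<in> K \<Longrightarrow> over P \<Longrightarrow> over (smult x P)"
  by (simp add: over_def mult_mem)

lemma over_monom_mult: "x \<in> K \<Longrightarrow> over P \<Longrightarrow> over (monom x n * P)"
  by (auto simp: over_def coeff_monom_mult mult_mem zero_mem)

text \<open>Long division divides only by the leading coefficient of \<open>M\<close>, so the
  remainder never leaves the polynomials over \<open>K\<close>.\<close>

lemma division_over:
  assumes "over P" "over M" "M \<noteq> 0"
  shows "\<exists>Q R. P = Q * M + R \<and> over R \<and> (R = 0 \<or> degree R < degree M)"
  using assms(1)
proof (induction "degree P" arbitrary: P rule: less_induct)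
  case less
  show ?case
  proof (cases "P = 0 \<or> degree P < degree M")
    case True
    then have "P = 0 * M + P \<and> over P \<and> (P = 0 \<or> degree P < degree M)"
      using less.prems by auto
    then show ?thesis by blast
  next
    case False
    define T where "T = monom (lead_coeff P / lead_coeff M) (degree P - degree M)"
    have over: "over (P - T * M)"
      unfolding T_def using less.prems assms(2)
      by (intro over_diff over_monom_mult divide_mem) (auto simp: over_def)
    have lc: "coeff (P - T * M) (degree P) = 0"
      using False assms(3) by (simp add: T_def coeff_monom_mult)
    have "degree T \<le> degree P - degree M"
      by (simp add: T_def degree_monom_le)
    then have "degree (T * M) \<le> degree P"
      using degree_mult_le[of T M] False by linarith
    then have le: "degree (P - T * M) \<le> degree P"
      by (simp add: degree_diff_le)
    show ?thesis
    proof (cases "P - T * M = 0")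
      case True
      then have "P = T * M + 0 \<and> over 0 \<and> (0 = (0::complex poly fract poly) \<or> degree 0 < degree M)"
        by (simp add: over_def zero_mem)
      then show ?thesis by blast
    next
      case ne: False
      then have "degree (P - T * M) < degree P"
        using le lc by (metis le_neq_implies_less leading_coeff_0_iff)
      from less.hyps[OF this over] obtain Q R where
        "P - T * M = Q * M + R" "over R" "R = 0 \<or> degree R < degree M"
        by blast
      then have "P = (T + Q) * M + R \<and> over R \<and> (R = 0 \<or> degree R < degree M)"
        by (simp add: algebra_simps)
      then show ?thesis by blast
    qed
  qed
qed

end

section \<open>Polynomials with constant coefficients and substitution of rational functions\<close>

definition zvar :: "complex poly fract" where
  "zvar = to_fract [:0, 1:]"

text \<open>Moves \<open>p\<close> to an outer variable t with constant coefficients, so that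
  \<open>poly (cpoly p) u\<close> is the substitution of the rational function \<open>u\<close> into
  \<open>p\<close>.\<close>

definition cpoly :: "complex poly \<Rightarrow> complex poly fract poly" where
  "cpoly p = map_poly (\<lambda>c. to_fract [:c:]) p"

lemma to_fract_pCons: "to_fract (pCons c p) = to_fract [:c:] + zvar * to_fract p"
proof -
  have "to_fract [:c:] + zvar * to_fract p = to_fract ([:c:] + [:0, 1:] * p)"
    by (simp only: zvar_def to_fract_add to_fract_mult)
  then show ?thesis by simp
qed

lemma coeff_cpoly [simp]: "coeff (cpoly p) i = to_fract [:coeff p i:]"
  by (simp add: cpoly_def coeff_map_poly)

lemma degree_cpoly [simp]: "degree (cpoly p) = degree p"
  unfolding cpoly_def by (rule degree_map_poly) simp

lemma poly_cpoly_zvar [simp]: "poly (cpoly p) zvar = to_fract p"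
proof (induction p)
  case (pCons c p)
  have "cpoly (pCons c p) = pCons (to_fract [:c:]) (cpoly p)"
    by (simp add: cpoly_def map_poly_pCons)
  then show ?case using pCons by (simp add: to_fract_pCons[of c p])
qed (simp add: cpoly_def)

lemma cpoly_add: "cpoly (p + q) = cpoly p + cpoly q"
  by (rule poly_eqI) (simp flip: to_fract_add)

lemma to_fract_const_mult: "to_fract [:a * b:] = to_fract [:a:] * to_fract [:b:]"
  by (simp flip: to_fract_mult)

lemma to_fract_const_add: "to_fract [:a + b:] = to_fract [:a:] + to_fract [:b:]"
  by (simp flip: to_fract_add)

lemma to_fract_const_sum: "to_fract [:\<Sum>i\<in>A. f i:] = (\<Sum>i\<in>A. to_fract [:f i:])"
  by (induction A rule: infinite_finite_induct) (simp_all add: to_fract_const_add)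

lemma to_fract_smult: "to_fract (smult c p) = to_fract [:c:] * to_fract p"
  by (simp flip: to_fract_mult)

lemma cpoly_mult: "cpoly (p * q) = cpoly p * cpoly q"
  by (rule poly_eqI) (simp add: coeff_mult to_fract_const_mult to_fract_const_sum)

lemma cpoly_const: "cpoly [:c:] = [:to_fract [:c:]:]"
  by (simp add: cpoly_def map_poly_pCons)

text \<open>The polynomial \<open>b(z) a(t) - a(z) b(t)\<close>, with \<open>z\<close> in the coefficients and \<open>t\<close> outermost.\<close>

definition pencil :: "complex poly \<Rightarrow> complex poly \<Rightarrow> complex poly poly" where
  "pencil a b = smult b (map_poly (\<lambda>c. [:c:]) a) - smult a (map_poly (\<lambda>c. [:c:]) b)"

lemma coeff_pencil: "coeff (pencil a b) i = smult (coeff a i) b - smult (coeff b i) a"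
  by (simp add: pencil_def coeff_map_poly)

text \<open>Up to the unit \<open>to_fract b\<close>, the pencil is a(t) - u b(t) with u = a/b: a
  polynomial over C(u) that has z as a root.\<close>

lemma fract_poly_pencil:
  assumes "b \<noteq> 0"
  shows "fract_poly (pencil a b) = smult (to_fract b) (cpoly a - smult (Fract a b) (cpoly b))"
proof (rule poly_eqI)
  fix i
  show "coeff (fract_poly (pencil a b)) i
      = coeff (smult (to_fract b) (cpoly a - smult (Fract a b) (cpoly b))) i"
    using assms
    by (simp add: coeff_map_poly coeff_pencil Fract_conv_to_fract to_fract_smult field_simps)
qed

lemma poly_map_const: "poly (map_poly (\<lambda>c. [:c:]) p) [:t:] = [:poly p t:]"
  by (induction p) (simp_all add: map_poly_pCons mult.commute)

lemma poly_pencil: "poly (pencil a b) [:t:] = smult (poly a t) b - smult (poly b t) a"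
  by (simp add: pencil_def poly_map_const)

text \<open>The degree in the inner variable is additive. Let m and n be the last outer indices at
  which \<open>G\<close> and \<open>H\<close> attain their inner degrees g and h; then only the
  product of these two coefficients contributes to the coefficient of \<open>G * H\<close> at outer
  index m + n and inner index g + h.\<close>

lemma inner_degree_cofactor:
  fixes G H :: "'a::idom poly poly"
  assumes "H \<noteq> 0" "\<And>i. degree (coeff (G * H) i) \<le> N" "N \<le> degree (coeff G j)" "G \<noteq> 0"
  shows "degree (coeff H i) = 0"
proof -
  have top: "\<exists>m. coeff P m \<noteq> 0 \<and> (\<forall>i. degree (coeff P i) \<le> degree (coeff P m)) \<and>
      (\<forall>i>m. coeff P i = 0 \<or> degree (coeff P i) < degree (coeff P m))"
    if "P \<noteq> 0" for P :: "'a poly poly"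
  proof -
    define D where "D = Max ((\<lambda>i. degree (coeff P i)) ` {..degree P})"
    have D: "degree (coeff P i) \<le> D" for i
      by (cases "i \<le> degree P") (auto simp: D_def coeff_eq_0 intro!: Max_ge)
    have "D \<in> (\<lambda>i. degree (coeff P i)) ` {..degree P}"
      unfolding D_def by (intro Max_in) auto
    then obtain i0 where i0: "degree (coeff P i0) = D" by auto
    \<comment> \<open>Zero coefficients also have degree 0, so for \<open>D = 0\<close> they have to
      be excluded explicitly.\<close>
    define S where "S = {i. degree (coeff P i) = D \<and> coeff P i \<noteq> 0}"
    have fin: "finite S"
      by (rule finite_subset[of _ "{..degree P}"]) (auto simp: S_def intro: le_degree)
    have "S \<noteq> {}"
    proof (cases "coeff P i0 = 0")
      case True
      then have "D = 0" using i0 by simp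
      then show ?thesis using that D by (auto simp: S_def intro!: exI[of _ "degree P"])
    qed (use i0 in \<open>auto simp: S_def\<close>)
    then have m: "Max S \<in> S" using fin by simp
    have "coeff P i = 0 \<or> degree (coeff P i) < D" if "i > Max S" for i
      using that D[of i] fin by (auto simp: S_def dest!: Max_ge[of _ i] intro: le_neq_implies_less)
    then show ?thesis using m D by (intro exI[of _ "Max S"]) (auto simp: S_def)
  qed
  obtain m where m: "coeff G m \<noteq> 0" "\<And>i. degree (coeff G i) \<le> degree (coeff G m)"
      "\<And>i. i > m \<Longrightarrow> coeff G i = 0 \<or> degree (coeff G i) < degree (coeff G m)"
    using top[OF assms(4)] by blast
  obtain n where n: "coeff H n \<noteq> 0" "\<And>i. degree (coeff H i) \<le> degree (coeff H n)"
      "\<And>i. i > n \<Longrightarrow> coeff H i = 0 \<or> degree (coeff H i) < degree (coeff H n)"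
    using top[OF assms(1)] by blast
  define g h where "g = degree (coeff G m)" and "h = degree (coeff H n)"
  have "coeff (coeff (G * H) (m + n)) (g + h)
      = (\<Sum>i\<le>m + n. coeff (coeff G i * coeff H (m + n - i)) (g + h))"
    by (simp add: coeff_mult coeff_sum)
  also have "\<dots> = (\<Sum>i\<le>m + n. if i = m then coeff (coeff G m * coeff H n) (g + h) else 0)"
  proof (rule sum.cong)
    fix i assume i: "i \<in> {..m + n}"
    show "coeff (coeff G i * coeff H (m + n - i)) (g + h)
        = (if i = m then coeff (coeff G m * coeff H n) (g + h) else 0)"
    proof (cases "i = m")
      case False
      have "coeff G i * coeff H (m + n - i) = 0 \<or>
          degree (coeff G i) + degree (coeff H (m + n - i)) < g + h"
      proof (cases "i > m")
        case True
        then show ?thesis using m(3)[of i] n(2)[of "m + n - i"] by (auto simp: g_def h_def)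
      next
        case l: False
        then have "m + n - i > n" using False i by auto
        then show ?thesis using n(3)[of "m + n - i"] m(2)[of i] by (auto simp: g_def h_def)
      qed
      then have "coeff (coeff G i * coeff H (m + n - i)) (g + h) = 0"
        by (metis coeff_0 coeff_eq_0 degree_mult_le le_less_trans)
      then show ?thesis using False by simp
    qed simp
  qed simp
  also have "\<dots> = lead_coeff (coeff G m) * lead_coeff (coeff H n)"
    by (simp add: g_def h_def coeff_mult_degree_sum)
  finally have "coeff (coeff (G * H) (m + n)) (g + h) \<noteq> 0" using m n by simp
  then have "g + h \<le> N" using assms(2)[of "m + n"] le_degree le_trans by blast
  moreover have "N \<le> g" using assms(3) m(2)[of j] by (simp add: g_def)
  ultimately have "h = 0" by simp
  then show ?thesis using n(2)[of i] by (simp add: h_def)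
qed

section \<open>Lueroth's theorem\<close>

text \<open>The complex numbers are algebraically closed, so a common divisor of positive degree has
  a root.\<close>

lemma coprime_poly_iff:
  fixes p q :: "complex poly"
  shows "coprime p q \<longleftrightarrow> (\<forall>z. \<not> (poly p z = 0 \<and> poly q z = 0))"
proof
  assume "coprime p q"
  then have "is_unit [:- z, 1:]" if "poly p z = 0 \<and> poly q z = 0" for z
    using that coprime_common_divisor[of p q "[:- z, 1:]"] by (simp add: poly_eq_0_iff_dvd)
  then show "\<forall>z. \<not> (poly p z = 0 \<and> poly q z = 0)"
    by (auto simp: is_unit_poly_iff)
next
  assume *: "\<forall>z. \<not> (poly p z = 0 \<and> poly q z = 0)"
  show "coprime p q"
  proof (rule coprimeI)
    fix d assume d: "d dvd p" "d dvd q"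
    have "degree d = 0"
    proof (rule ccontr)
      assume "degree d \<noteq> 0"
      then have "\<not> (\<exists>c l. c \<noteq> 0 \<and> l = 0 \<and> d = pCons c l)" by auto
      then obtain z where "poly d z = 0"
        using fundamental_theorem_of_algebra_alt[of d] by blast
      then show False using d * by (auto elim!: dvdE)
    qed
    moreover have "d \<noteq> 0" using d * by auto
    ultimately show "is_unit d" by (simp add: is_unit_iff_degree)
  qed
qed

text \<open>If \<open>c\<close> is nonzero, \<open>b\<close> divides \<open>a\<close> and is a unit
  by coprimality; if \<open>c\<close> is zero, \<open>b\<close> vanishes and \<open>a\<close> is a
  unit.\<close>

lemma pencil_dependent_imp_const:
  fixes a b :: "complex poly"
  assumes "coprime a b" "smult c a = smult d b" "c \<noteq> 0 \<or> d \<noteq> 0"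
  shows "degree a = 0" "degree b = 0"
proof -
  have "degree a = 0 \<and> degree b = 0" 
  proof (cases "c = 0")
    case True
    then have "b = 0" using assms by auto
    then show ?thesis using assms(1) by (auto simp: is_unit_poly_iff)
  next
    case False
    then have a: "a = smult (d / c) b"
      using assms(2) by (metis smult_smult divide_inverse_commute left_inverse smult_1_left)
    then have "b dvd a" by (metis dvd_refl dvd_smult)
    then have "is_unit b" using assms(1) by (metis coprime_common_divisor dvd_refl)
    then have "degree b = 0" by (auto simp: is_unit_poly_iff)
    then show ?thesis using a by simp
  qed
  then show "degree a = 0" "degree b = 0" by auto
qed

text \<open>A vanishing coefficient at \<open>N\<close> would be a linear relation between
  \<open>a\<close> and \<open>b\<close>.\<close>

lemma degree_pencil:
  assumes "coprime a b" "max (degree a) (degree b) = N" "N \<ge> 1"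
  shows "degree (pencil a b) = N" "pencil a b \<noteq> 0"
proof -
  have "coeff (pencil a b) N \<noteq> 0"
  proof
    assume "coeff (pencil a b) N = 0"
    then have *: "smult (coeff b N) a = smult (coeff a N) b" by (simp add: coeff_pencil)
    have "coeff b N \<noteq> 0 \<or> coeff a N \<noteq> 0"
      using assms(2,3) by (metis degree_0 leading_coeff_0_iff max_def not_one_le_zero)
    then show False
      using pencil_dependent_imp_const[OF assms(1) *] assms by auto
  qed
  moreover have "coeff (pencil a b) i = 0" if "i > N" for i
    using that assms(2) by (auto simp: coeff_pencil coeff_eq_0)
  ultimately show "degree (pencil a b) = N" "pencil a b \<noteq> 0"
    by (metis coeff_0 degree_le le_antisym le_degree not_le, auto)
qed

context function_field
begin

lemma over_cpoly: "over (cpoly p)"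
  by (simp add: over_def const_mem)

text \<open>Up to a factor, \<open>M\<close> is the minimal polynomial of \<open>x\<close> over
  \<open>K\<close>: dividing another annihilator by one of least degree leaves an annihilator of
  smaller degree, hence 0.\<close>

lemma minimal_annihilator:
  assumes "over P0" "P0 \<noteq> 0" "poly P0 x = 0"
  obtains M where "over M" "M \<noteq> 0" "poly M x = 0"
    "\<And>P. over P \<Longrightarrow> poly P x = 0 \<Longrightarrow> M dvd P"
proof -
  define Q where "Q P \<longleftrightarrow> over P \<and> P \<noteq> 0 \<and> poly P x = 0" for P
  have "Q P0" using assms by (simp add: Q_def)
  then obtain M where M: "Q M" "\<And>P. Q P \<Longrightarrow> degree M \<le> degree P"
    using exists_least_lemma ex_has_least_nat[of Q P0 degree] by blast
  show ?thesis
  proof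
    fix P assume P: "over P" "poly P x = 0"
    obtain A R where AR: "P = A * M + R" "over R" "R = 0 \<or> degree R < degree M"
      using division_over[OF P(1), of M] M(1) by (auto simp: Q_def)
    then have "poly R x = 0" using P(2) M(1) by (simp add: Q_def)
    then have "R = 0" using AR M(2)[of R] by (metis Q_def not_le)
    then show "M dvd P" using AR(1) by simp
  qed (use M(1) in \<open>auto simp: Q_def\<close>)
qed

end

text \<open>The name anticipates \<open>lueroth\<close>: what is assumed is least degree among the
  nonconstant members of \<open>K\<close>, and generation is proved from it. In \<open>least\<close>
  the degree condition excludes \<open>q = 0\<close>, where \<open>Fract p q\<close> would be
  0.\<close>

locale minimal_generator = function_field +
  fixes a b :: "complex poly" and N :: nat
  assumes cop: "coprime a b" and mem: "Fract a b \<in> K"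
    and deg: "max (degree a) (degree b) = N" and N: "N \<ge> 1"
    and least: "\<And>p q. coprime p q \<Longrightarrow> Fract p q \<in> K \<Longrightarrow> max (degree p) (degree q) \<ge> 1 \<Longrightarrow>
      N \<le> max (degree p) (degree q)"
begin

lemma b_nz: "b \<noteq> 0"
  using cop deg N by (auto simp: is_unit_poly_iff)

text \<open>The degrees in both variables of the primitive minimal polynomial \<open>G(z,t)\<close> of \<open>z\<close> over
  \<open>K\<close> are \<open>N\<close>: some quotient of its coefficients is a nonconstant element of \<open>K\<close>, which
  bounds the degree in \<open>z\<close> from below, and \<open>G\<close> divides \<open>b(z) a(t) - a(z) b(t)\<close>.\<close>

lemma annihilator_degree:
  assumes "over P" "P \<noteq> 0" "poly P zvar = 0"
  shows "N \<le> degree P"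
proof -
  obtain M where M: "over M" "M \<noteq> 0" "poly M zvar = 0"
      "\<And>P. over P \<Longrightarrow> poly P zvar = 0 \<Longrightarrow> M dvd P"
    using minimal_annihilator[OF assms] by metis
  \<comment> \<open>Denominators and content are cleared. The quotients of coefficients of
    \<open>G\<close> are those of \<open>M\<close>, hence they lie in \<open>K\<close>.\<close>
  define G where "G = primitive_part_fract M"
  have cont: "content G = 1" using M(2) by (simp add: G_def)
  have M_eq: "M = smult (fract_content M) (fract_poly G)"
    by (simp add: G_def content_times_primitive_part_fract)
  have fc: "fract_content M \<noteq> 0" using M(2) by simp
  have G_nz: "G \<noteq> 0" using cont by auto
  have degM: "degree M = degree G" 
    by (subst M_eq) (use fc in \<open>simp add: degree_map_poly del: fract_content_eq_0_iff\<close>)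
  define l where "l = lead_coeff G"
  have l: "l \<noteq> 0" using G_nz by (simp add: l_def)
  have ratio: "Fract (coeff G i) l \<in> K" for i
  proof -
    have "coeff M i / coeff M (degree G) \<in> K"
      using M(1) by (intro divide_mem) (auto simp: over_def)
    moreover have "coeff M j = fract_content M * to_fract (coeff G j)" for j
      by (subst M_eq) (simp add: coeff_map_poly)
    ultimately show ?thesis using fc by (simp add: Fract_conv_to_fract l_def)
  qed
  have "\<exists>j. N \<le> degree (coeff G j)"
  proof (cases "\<forall>i. \<exists>c. coeff G i = smult c l")
    \<comment> \<open>Primitivity would make \<open>l\<close> a constant and \<open>G\<close> free
      of z; then z would be a root of a nonzero polynomial with constant coefficients, although it
      is transcendental.\<close>
    case True
    then obtain c where c: "\<And>i. coeff G i = smult (c i) l" by metis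
    have "[:l:] dvd G" by (subst const_poly_dvd_iff) (simp add: c dvd_smult)
    then have "l dvd 1" using cont by (simp add: const_poly_dvd_iff_dvd_content)
    then have l0: "degree l = 0" by (simp add: is_unit_iff_degree l)
    then have c0: "coeff G i = [:coeff (coeff G i) 0:]" for i
      by (metis c degree_smult_le degree_0_id le_zero_eq)
    define g where "g = map_poly (\<lambda>x. coeff x 0) G"
    have "fract_poly G = cpoly g"
      by (rule poly_eqI) (simp add: coeff_map_poly g_def flip: c0)
    then have "to_fract g = 0"
      using M(3) fc by (subst (asm) M_eq) simp
    then have "g = 0" by simp
    then have "coeff G i = 0" for i using c0[of i] by (simp add: poly_eq_iff g_def coeff_map_poly)
    then show ?thesis using G_nz by (simp add: poly_eq_iff)
  next
    case False
    then obtain i where i: "\<And>c. coeff G i \<noteq> smult c l" by blast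
    obtain p q g where pq: "coeff G i = p * g" "l = q * g" "coprime p q"
    proof -
      have "gcd (coeff G i) l \<noteq> 0" using l by simp
      then show ?thesis using gcd_coprime_exists[of "coeff G i" l] that by blast
    qed
    have nz: "q \<noteq> 0" "g \<noteq> 0" using l pq by auto
    have "Fract p q = Fract (coeff G i) l" using nz by (simp add: pq eq_fract)
    then have K: "Fract p q \<in> K" using ratio by simp
    have "\<not> (degree p = 0 \<and> degree q = 0)"
    proof
      assume "degree p = 0 \<and> degree q = 0"
      then obtain x y where "p = [:x:]" "q = [:y:]" by (auto elim!: degree_eq_zeroE)
      then have "coeff G i = smult (x / y) l" using nz by (simp add: pq)
      then show False using i by blast
    qed
    then have "N \<le> max (degree p) (degree q)" by (intro least[OF pq(3) K]) auto
    moreover have "degree p \<le> degree (coeff G i)"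
      using nz pq(1) by (cases "p = 0") (simp_all add: degree_mult_eq)
    moreover have "degree q \<le> degree (coeff G (degree G))"
      using nz pq(2) by (simp add: degree_mult_eq flip: l_def)
    ultimately have "N \<le> degree (coeff G i) \<or> N \<le> degree (coeff G (degree G))"
      by linarith
    then show ?thesis by blast
  qed
  then obtain j where j: "N \<le> degree (coeff G j)" by blast
  have "over (cpoly a - smult (Fract a b) (cpoly b))"
    by (intro over_diff over_smult over_cpoly mem)
  moreover have "poly (cpoly a - smult (Fract a b) (cpoly b)) zvar = 0"
    using b_nz by (simp add: Fract_conv_to_fract)
  ultimately have "M dvd fract_poly (pencil a b)"
    using M(4) by (simp add: fract_poly_pencil b_nz dvd_smult)
  then have "fract_poly G dvd fract_poly (pencil a b)"
    by (subst (asm) M_eq) (simp add: smult_dvd_iff M(2))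
  \<comment> \<open>Gauss's lemma: as \<open>G\<close> is primitive, divisibility over C(z) descends
    to C[z].\<close>
  then have "G dvd pencil a b" using cont by (rule fract_poly_dvdD)
  then obtain H where H: "pencil a b = G * H" by (elim dvdE)
  have H_nz: "H \<noteq> 0" using H degree_pencil(2)[OF cop deg N] by auto
  have "degree (coeff (G * H) i) \<le> N" for i
    unfolding H[symmetric] coeff_pencil using deg
    by (intro degree_diff_le) (auto intro: order.trans[OF degree_smult_le])
  then have H0: "degree (coeff H i) = 0" for i
    using inner_degree_cofactor[OF H_nz _ j G_nz] by blast
  \<comment> \<open>The cofactor is free of z, so a root t of it would make b(z) a(t) - a(z) b(t)
    vanish identically in z, a linear relation between \<open>a\<close> and
    \<open>b\<close>.\<close>
  have "degree H = 0"
  proof (rule ccontr)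
    assume dH: "degree H \<noteq> 0"
    define h where "h = map_poly (\<lambda>x. coeff x 0) H"
    have Hh: "H = map_poly (\<lambda>c. [:c:]) h"
      by (rule poly_eqI) (simp add: coeff_map_poly h_def degree_0_id H0)
    have "degree h = degree H" by (subst Hh) (simp add: degree_map_poly)
    then have "\<not> (\<exists>c l. c \<noteq> 0 \<and> l = 0 \<and> h = pCons c l)" using dH by auto
    then obtain t where t: "poly h t = 0"
      using fundamental_theorem_of_algebra_alt[of h] by blast
    have "poly (pencil a b) [:t:] = 0"
      by (simp add: H) (simp add: Hh poly_map_const t)
    then have *: "smult (poly b t) a = smult (poly a t) b" by (simp add: poly_pencil)
    have "poly b t \<noteq> 0 \<or> poly a t \<noteq> 0" using cop by (auto simp: coprime_poly_iff)
    from pencil_dependent_imp_const[OF cop * this] deg N show False by auto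
  qed
  then have "degree G = N"
    using H degree_pencil[OF cop deg N] G_nz H_nz by (simp add: degree_mult_eq)
  moreover have "degree M \<le> degree P"
    using M(4)[OF assms(1,3)] assms(2) by (rule dvd_imp_degree_le)
  ultimately show ?thesis using degM by simp
qed

end

section \<open>Homogeneous substitution\<close>

text \<open>The homogenization of \<open>r\<close> to degree \<open>e\<close>, evaluated at numbers and at polynomials.\<close>

definition form_eval :: "nat \<Rightarrow> complex poly \<Rightarrow> complex \<Rightarrow> complex \<Rightarrow> complex" where
  "form_eval e r x y = (\<Sum>i\<le>e. coeff r i * (x ^ i * y ^ (e - i)))"

definition hom_subst :: "nat \<Rightarrow> complex poly \<Rightarrow> complex poly \<Rightarrow> complex poly \<Rightarrow> complex poly" where
  "hom_subst e r a b = (\<Sum>i\<le>e. smult (coeff r i) (a ^ i * b ^ (e - i)))"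

lemma poly_hom_subst: "poly (hom_subst e r a b) z = form_eval e r (poly a z) (poly b z)"
  by (simp add: hom_subst_def form_eval_def poly_sum)

lemma poly_eq_sum_le:
  fixes p :: "'a::comm_semiring_1 poly"
  assumes "degree p \<le> n"
  shows "poly p x = (\<Sum>i\<le>n. coeff p i * x ^ i)"
  unfolding poly_altdef using assms
  by (intro sum.mono_neutral_left) (auto simp: coeff_eq_0)

lemma form_eval_nz:
  assumes "degree r \<le> e" "y \<noteq> 0"
  shows "form_eval e r x y = y ^ e * poly r (x / y)"
proof -
  have "poly r (x / y) = (\<Sum>i\<le>e. coeff r i * (x / y) ^ i)"
    using assms(1) by (rule poly_eq_sum_le)
  then show ?thesis
    using assms(2) by (simp add: form_eval_def sum_distrib_left power_divide power_diff mult_ac)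
qed

lemma form_eval_0: "form_eval e r x 0 = coeff r e * x ^ e"
proof -
  have "form_eval e r x 0 = (\<Sum>i\<le>e. if i = e then coeff r e * x ^ e else 0)"
    unfolding form_eval_def by (rule sum.cong) auto
  then show ?thesis by simp
qed

lemma form_eval_scale: "form_eval e r (c * x) (c * y) = c ^ e * form_eval e r x y"
proof -
  have "(c * x) ^ i * (c * y) ^ (e - i) = c ^ e * (x ^ i * y ^ (e - i))" if "i \<le> e" for i
    using that by (simp add: power_mult_distrib flip: power_add)
  then show ?thesis by (simp add: form_eval_def sum_distrib_left mult_ac)
qed

lemma coeff_max_nz:
  fixes r s :: "complex poly"
  assumes "coprime r s" "e = max (degree r) (degree s)"
  shows "\<not> (coeff r e = 0 \<and> coeff s e = 0)"
proof
  assume *: "coeff r e = 0 \<and> coeff s e = 0"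
  have "r \<noteq> 0 \<or> s \<noteq> 0" using assms(1) by auto
  then show False using * assms(2)
    by (metis degree_0 leading_coeff_0_iff le_zero_eq max.cobounded1 max.cobounded2 max_def)
qed

text \<open>At \<open>y = 0\<close> the two values are the coefficients at \<open>e\<close> times a
  power of \<open>x\<close>, and one of these coefficients is nonzero because \<open>e\<close> is
  the exact common degree.\<close>

lemma form_eval_coprime:
  assumes "coprime r s" "e = max (degree r) (degree s)" "\<not> (x = 0 \<and> y = 0)"
  shows "\<not> (form_eval e r x y = 0 \<and> form_eval e s x y = 0)"
proof (cases "y = 0")
  case True
  then show ?thesis using coeff_max_nz[OF assms(1,2)] assms(3) by (auto simp: form_eval_0)
next
  case False
  then show ?thesis using assms by (auto simp: form_eval_nz coprime_poly_iff)
qed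

lemma coprime_hom_subst:
  assumes "coprime r s" "e = max (degree r) (degree s)" "coprime a b"
  shows "coprime (hom_subst e r a b) (hom_subst e s a b)"
  using form_eval_coprime[OF assms(1,2)] assms(3) unfolding coprime_poly_iff poly_hom_subst by blast

lemma coeff_mult_le:
  fixes p q :: "'a::comm_semiring_0 poly"
  assumes "degree p \<le> m" "degree q \<le> n"
  shows "coeff (p * q) (m + n) = coeff p m * coeff q n"
proof -
  have "coeff p i * coeff q (m + n - i) = (if i = m then coeff p m * coeff q n else 0)" for i
    using assms by (cases i m rule: linorder_cases) (auto simp: coeff_eq_0)
  then show ?thesis by (simp add: coeff_mult)
qed

lemma coeff_power_le:
  fixes p :: "'a::comm_semiring_1 poly"
  assumes "degree p \<le> m"
  shows "coeff (p ^ n) (n * m) = coeff p m ^ n" "degree (p ^ n) \<le> n * m"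
proof -
  show deg: "degree (p ^ n) \<le> n * m" for n
    using assms degree_power_le[of p n] by (metis le_trans mult.commute mult_le_mono2)
  show "coeff (p ^ n) (n * m) = coeff p m ^ n"
  proof (induction n)
    case (Suc n)
    then show ?case using coeff_mult_le[OF assms deg[of n]] by simp
  qed simp
qed

lemma
  assumes "degree a \<le> N" "degree b \<le> N"
  shows degree_hom_subst_le: "degree (hom_subst e r a b) \<le> e * N"
    and coeff_hom_subst: "coeff (hom_subst e r a b) (e * N) = form_eval e r (coeff a N) (coeff b N)"
proof -
  have eq: "i * N + (e - i) * N = e * N" if "i \<le> e" for i
    using that by (simp flip: add_mult_distrib)
  have "degree (a ^ i * b ^ (e - i)) \<le> e * N" if "i \<le> e" for i
    using degree_mult_le[of "a ^ i" "b ^ (e - i)"] coeff_power_le(2)[OF assms(1), of i]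
      coeff_power_le(2)[OF assms(2), of "e - i"] eq[OF that] by linarith
  then show "degree (hom_subst e r a b) \<le> e * N"
    unfolding hom_subst_def by (intro degree_sum_le) (auto intro: order.trans[OF degree_smult_le])
  have "coeff (a ^ i * b ^ (e - i)) (e * N) = coeff a N ^ i * coeff b N ^ (e - i)" if "i \<le> e" for i
    using coeff_mult_le[OF coeff_power_le(2)[OF assms(1)] coeff_power_le(2)[OF assms(2)], of i "e - i"]
    by (simp add: eq[OF that] coeff_power_le(1) assms)
  then show "coeff (hom_subst e r a b) (e * N) = form_eval e r (coeff a N) (coeff b N)"
    by (simp add: hom_subst_def form_eval_def coeff_sum)
qed

text \<open>The degree is multiplicative under composition. The coefficients at \<open>e * N\<close>
  are the homogeneous coordinates of the composite at infinity, so they do not both vanish.\<close>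

lemma max_degree_hom_subst:
  assumes "coprime r s" "e = max (degree r) (degree s)"
    and "coprime a b" "N = max (degree a) (degree b)"
  shows "max (degree (hom_subst e r a b)) (degree (hom_subst e s a b)) = e * N"
proof (rule antisym)
  show "max (degree (hom_subst e r a b)) (degree (hom_subst e s a b)) \<le> e * N"
    using assms(4) by (auto intro!: degree_hom_subst_le)
  have "\<not> (coeff (hom_subst e r a b) (e * N) = 0 \<and> coeff (hom_subst e s a b) (e * N) = 0)"
    using form_eval_coprime[OF assms(1,2) coeff_max_nz[OF assms(3,4)]] assms(4) by (simp add: coeff_hom_subst)
  then show "e * N \<le> max (degree (hom_subst e r a b)) (degree (hom_subst e s a b))"
    by (meson le_degree max.coboundedI1 max.coboundedI2)
qed

lemma hom_subst_smult: "hom_subst e (smult c r) a b = smult c (hom_subst e r a b)"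
  by (intro poly_eqI) (simp add: hom_subst_def coeff_sum sum_distrib_left mult_ac)

lemma hom_subst_one: "hom_subst 1 r a b = smult (coeff r 1) a + smult (coeff r 0) b"
  by (simp add: hom_subst_def)

lemma fract_hom_subst:
  assumes "degree r \<le> e" "b \<noteq> 0"
  shows "to_fract (hom_subst e r a b) = to_fract b ^ e * poly (cpoly r) (Fract a b)"
proof -
  have pow: "to_fract (x ^ n) = to_fract x ^ n" for x :: "complex poly" and n
    by (induction n) simp_all
  have "poly (cpoly r) (Fract a b) = (\<Sum>i\<le>e. coeff (cpoly r) i * Fract a b ^ i)"
    using assms(1) by (intro poly_eq_sum_le) simp
  moreover have "to_fract (smult (coeff r i) (a ^ i * b ^ (e - i)))
      = to_fract b ^ e * (coeff (cpoly r) i * Fract a b ^ i)" if "i \<le> e" for i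
  proof -
    have "to_fract b ^ (e - i) = to_fract b ^ e / to_fract b ^ i"
      using that assms(2) by (simp add: power_diff)
    then show ?thesis
      by (simp only: to_fract_smult to_fract_mult pow coeff_cpoly Fract_conv_to_fract power_divide)
        simp
  qed
  ultimately show ?thesis by (simp add: hom_subst_def sum_distrib_left)
qed

lemma coprime_cross_dvd:
  fixes p q p' q' :: "complex poly"
  assumes "coprime p q" "p * q' = p' * q"
  obtains g where "p' = p * g" "q' = q * g"
proof (cases "p = 0")
  case True
  then have "is_unit q" using assms(1) by simp
  then have "q \<noteq> 0" "q dvd q'" by auto
  then show ?thesis using True assms(2) that by (auto elim!: dvdE)
next
  case False
  have "p dvd p' * q" by (simp flip: assms(2))
  then have "p dvd p'" using assms(1) by (simp add: coprime_dvd_mult_left_iff)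
  then obtain g where g: "p' = p * g" by (elim dvdE)
  then show ?thesis using assms(2) False that by (auto simp: mult_ac)
qed

lemma coprime_cross_eq:
  fixes p q p' q' :: "complex poly"
  assumes "coprime p q" "coprime p' q'" "p * q' = p' * q"
  obtains c where "c \<noteq> 0" "p' = smult c p" "q' = smult c q"
proof -
  obtain g where g: "p' = p * g" "q' = q * g"
    using assms(1,3) by (rule coprime_cross_dvd)
  then have "is_unit g" using assms(2) by (metis coprime_common_divisor dvd_triv_right)
  then have "g \<noteq> 0" "\<exists>c. g = [:c:]" by (auto simp: is_unit_poly_iff)
  then obtain c where "g = [:c:]" "c \<noteq> 0" by auto
  then show ?thesis using g that[of c] by simp
qed

section \<open>The field C(u) and generation by an element of least degree\<close>

definition adjoin :: "complex poly fract \<Rightarrow> complex poly fract set" where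
  "adjoin u = {poly (cpoly r) u / poly (cpoly s) u | r s. poly (cpoly s) u \<noteq> 0}"

lemma cpoly_1: "cpoly 1 = 1"
  by (simp add: cpoly_def flip: one_pCons)

lemma function_field_adjoin: "function_field (adjoin u)"
proof
  show "to_fract [:c:] \<in> adjoin u" for c
    unfolding adjoin_def
    by (intro CollectI exI[of _ "[:c:]"] exI[of _ 1]) (simp add: cpoly_1 cpoly_const)
  fix x assume "x \<in> adjoin u"
  then obtain r s where rs: "x = poly (cpoly r) u / poly (cpoly s) u" "poly (cpoly s) u \<noteq> 0"
    by (auto simp: adjoin_def)
  show "inverse x \<in> adjoin u"
  proof (cases "poly (cpoly r) u = 0")
    case True
    then have "inverse x = poly (cpoly 0) u / poly (cpoly 1) u" using rs by (simp add: cpoly_def)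
    then show ?thesis
      unfolding adjoin_def by (intro CollectI exI[of _ 0] exI[of _ 1]) (simp add: cpoly_1)
  next
    case False
    then show ?thesis using rs by (auto simp: adjoin_def)
  qed
  fix y assume "y \<in> adjoin u"
  then obtain r' s' where rs': "y = poly (cpoly r') u / poly (cpoly s') u" "poly (cpoly s') u \<noteq> 0"
    by (auto simp: adjoin_def)
  have "x * y = poly (cpoly (r * r')) u / poly (cpoly (s * s')) u"
    using rs rs' by (simp add: cpoly_mult)
  then show "x * y \<in> adjoin u"
    using rs rs' unfolding adjoin_def 
    by (intro CollectI exI[of _ "r * r'"] exI[of _ "s * s'"]) (simp add: cpoly_mult)
  have "x + y = poly (cpoly (r * s' + r' * s)) u / poly (cpoly (s * s')) u"
    using rs(2) rs'(2) by (simp add: rs(1) rs'(1) cpoly_mult cpoly_add add_frac_eq mult_ac)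
  then show "x + y \<in> adjoin u"
    using rs rs' unfolding adjoin_def 
    by (intro CollectI exI[of _ "r * s' + r' * s"] exI[of _ "s * s'"]) (simp add: cpoly_mult)
qed

context minimal_generator
begin

lemma adjoin_subset: "adjoin (Fract a b) \<subseteq> K"
proof -
  have "poly (cpoly r) (Fract a b) \<in> K" for r
  proof (induction r)
    case 0
    then show ?case by (simp add: cpoly_def zero_mem)
  next
    case (pCons c p)
    have "cpoly (pCons c p) = pCons (to_fract [:c:]) (cpoly p)"
      by (simp add: cpoly_def map_poly_pCons)
    then show ?case using pCons by (simp add: add_mem mult_mem const_mem mem)
  qed
  then show ?thesis by (auto simp: adjoin_def divide_mem)
qed

text \<open>Comparing remainders replaces the tower law for degrees of extensions. The polynomial
  \<open>E\<close> over C(u) has degree \<open>N\<close> and root z, so \<open>p\<close> and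
  \<open>q\<close> are values at z of polynomials \<open>R\<close> and \<open>S\<close> over C(u) of
  degree below \<open>N\<close>. Then \<open>R - smult (Fract p q) S\<close> is over
  \<open>K\<close> and annihilates z, so it is zero by \<open>annihilator_degree\<close>; a nonzero
  coefficient of \<open>S\<close> exhibits p/q as a quotient in C(u).\<close>

lemma generates:
  assumes "Fract p q \<in> K" "q \<noteq> 0"
  shows "Fract p q \<in> adjoin (Fract a b)"
proof -
  interpret C: function_field "adjoin (Fract a b)" by (rule function_field_adjoin)
  define E where "E = cpoly a - smult (Fract a b) (cpoly b)"
  have "Fract a b = poly (cpoly [:0, 1:]) (Fract a b) / poly (cpoly 1) (Fract a b)"
    using cpoly_1 by (simp add: cpoly_def map_poly_pCons flip: one_pCons)
  then have "Fract a b \<in> adjoin (Fract a b)"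
    unfolding adjoin_def by (intro CollectI exI[of _ "[:0, 1:]"] exI[of _ 1]) (simp add: cpoly_1)
  then have E: "C.over E"
    unfolding E_def by (intro C.over_diff C.over_smult C.over_cpoly)
  have fE: "fract_poly (pencil a b) = smult (to_fract b) E"
    by (simp add: E_def fract_poly_pencil b_nz)
  have "degree (fract_poly (pencil a b)) = degree E" 
    unfolding fE using b_nz by simp
  then have degE: "degree E = N"
    using degree_pencil(1)[OF cop deg N] by (simp add: degree_map_poly)
  then have E_nz: "E \<noteq> 0" using N by auto
  have Ez: "poly E zvar = 0"
    using b_nz by (simp add: E_def Fract_conv_to_fract)
  have rem: "\<exists>R. C.over R \<and> degree R < N \<and> poly R zvar = to_fract x" for x
  proof -
    obtain Q R where QR: "cpoly x = Q * E + R" "C.over R" "R = 0 \<or> degree R < degree E"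
      using C.division_over[OF C.over_cpoly[of x] E E_nz] by blast
    have "poly (cpoly x) zvar = poly R zvar" unfolding QR(1) by (simp add: Ez)
    moreover have "degree R < N" using QR(3) degE N by auto
    ultimately show ?thesis using QR(2) by (intro exI[of _ R]) simp
  qed
  obtain R where R: "C.over R" "degree R < N" "poly R zvar = to_fract p" using rem by blast
  obtain S where S: "C.over S" "degree S < N" "poly S zvar = to_fract q" using rem by blast
  define D where "D = R - smult (Fract p q) S"
  have "over R" "over S" using R S adjoin_subset by (auto simp: over_def C.over_def)
  then have "over D" unfolding D_def by (intro over_diff over_smult assms)
  moreover have "poly D zvar = 0" using R S assms(2) by (simp add: D_def Fract_conv_to_fract)
  moreover have "degree D < N"
    unfolding D_def using R S by (intro degree_diff_less) (auto intro: le_less_trans[OF degree_smult_le])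
  ultimately have "D = 0" using annihilator_degree[of D] by auto
  then have D: "R = smult (Fract p q) S" by (simp add: D_def)
  have "S \<noteq> 0" using S(3) assms(2) by auto
  then obtain i where i: "coeff S i \<noteq> 0" by (auto simp: poly_eq_iff)
  have "Fract p q = coeff R i / coeff S i" using i by (simp add: D)
  then show ?thesis using R(1) S(1) by (auto simp: C.over_def intro: C.divide_mem)
qed

text \<open>Once r/s is in lowest terms, so is its homogeneous substitution; it therefore agrees
  with p/q up to a constant, which is absorbed into \<open>r\<close> and \<open>s\<close>.\<close>

theorem lueroth:
  assumes "coprime p q" "Fract p q \<in> K" "q \<noteq> 0"
  obtains r s e where "coprime r s" "e = max (degree r) (degree s)"
    "p = hom_subst e r a b" "q = hom_subst e s a b"
proof -
  define u where "u = Fract a b"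
  obtain r0 s0 where rs0: "Fract p q = poly (cpoly r0) u / poly (cpoly s0) u" "poly (cpoly s0) u \<noteq> 0"
    using generates[OF assms(2,3)] by (auto simp: adjoin_def u_def)
  then have "s0 \<noteq> 0" by (auto simp: cpoly_def)
  then have "gcd r0 s0 \<noteq> 0" by simp
  then obtain r s g where rs: "r0 = r * g" "s0 = s * g" "coprime r s"
    using gcd_coprime_exists by blast
  define e where "e = max (degree r) (degree s)"
  have nz: "poly (cpoly g) u \<noteq> 0" "poly (cpoly s) u \<noteq> 0"
    using rs0(2) by (simp_all add: rs cpoly_mult)
  have "to_fract p / to_fract q = poly (cpoly r) u / poly (cpoly s) u"
    using rs0(1) nz by (simp add: rs cpoly_mult Fract_conv_to_fract)
  then have "to_fract p * poly (cpoly s) u = poly (cpoly r) u * to_fract q"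
    using nz assms(3) by (simp add: field_simps)
  then have "to_fract p * to_fract (hom_subst e s a b) = to_fract (hom_subst e r a b) * to_fract q"
    using b_nz by (simp add: fract_hom_subst e_def mult_ac flip: u_def)
  then have cross: "p * hom_subst e s a b = hom_subst e r a b * q"
    by (metis to_fract_eq_iff to_fract_mult)
  obtain c where c: "c \<noteq> 0" "hom_subst e r a b = smult c p" "hom_subst e s a b = smult c q"
    using coprime_cross_eq[OF assms(1) coprime_hom_subst[OF rs(3) e_def cop] cross] by metis
  show ?thesis
  proof (rule that)
    show "coprime (smult (1/c) r) (smult (1/c) s)" "e = max (degree (smult (1/c) r)) (degree (smult (1/c) s))"
      using rs(3) c(1) by (simp_all add: coprime_poly_iff e_def)
    show "p = hom_subst e (smult (1/c) r) a b" "q = hom_subst e (smult (1/c) s) a b"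
      using c by (simp_all add: hom_subst_smult)
  qed
qed

end

section \<open>Blaschke products as pairs of polynomials\<close>

text \<open>For degree at most \<open>n\<close> and nonzero z the value at z is z^n cnj (p (1 / cnj
  z)), the reflection of \<open>p\<close> in the unit circle. The explicit \<open>n\<close> allows
  numerator and denominator to be reflected to the same degree.\<close>

definition reflect :: "nat \<Rightarrow> complex poly \<Rightarrow> complex poly" where
  "reflect n p = (\<Sum>i\<le>n. monom (cnj (coeff p (n - i))) i)"

lemma coeff_reflect: "coeff (reflect n p) i = (if i \<le> n then cnj (coeff p (n - i)) else 0)"
proof -
  have "coeff (reflect n p) i = (\<Sum>j\<le>n. if j = i then cnj (coeff p (n - j)) else 0)"
    by (simp add: reflect_def coeff_sum)
  then show ?thesis by simp
qed

lemma degree_reflect: "degree (reflect n p) \<le> n"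
  by (rule degree_le) (simp add: coeff_reflect)

lemma poly_reflect:
  assumes "degree p \<le> n" "z \<noteq> 0"
  shows "poly (reflect n p) z = z ^ n * cnj (poly p (1 / cnj z))"
proof -
  have "poly (reflect n p) z = (\<Sum>i\<le>n. cnj (coeff p (n - i)) * z ^ i)"
    by (simp add: reflect_def poly_sum poly_monom)
  also have "\<dots> = (\<Sum>i\<le>n. cnj (coeff p i) * z ^ (n - i))"
    by (rule sum.reindex_bij_witness[of _ "\<lambda>i. n - i" "\<lambda>i. n - i"]) auto
  also have "\<dots> = z ^ n * cnj (\<Sum>i\<le>n. coeff p i * (1 / cnj z) ^ i)"
    using assms(2) by (simp add: sum_distrib_left power_diff power_divide mult_ac)
  finally show ?thesis using poly_eq_sum_le[OF assms(1), of "1 / cnj z"] by simp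
qed

lemma cnj_inverse_circle:
  assumes "norm z = 1"
  shows "1 / cnj z = z"
proof -
  have "z * cnj z = 1" using complex_norm_square[of z] assms by simp
  then show ?thesis by (metis nonzero_eq_divide_eq mult_zero_right zero_neq_one)
qed

lemma poly_reflect_circle:
  assumes "degree p \<le> n" "norm z = 1"
  shows "poly (reflect n p) z = z ^ n * cnj (poly p z)"
proof -
  have "z \<noteq> 0" using assms(2) by auto
  then show ?thesis using poly_reflect[OF assms(1), of z] cnj_inverse_circle[OF assms(2)] by simp
qed

lemma infinite_circle: "infinite {z::complex. norm z = 1}"
proof
  assume fin: "finite {z::complex. norm z = 1}"
  have "connected (sphere (0::complex) 1)" by (rule connected_sphere) simp
  moreover have "sphere (0::complex) 1 = {z. norm z = 1}" by (auto simp: dist_norm)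
  ultimately obtain x where "{z::complex. norm z = 1} = {x} \<or> {z::complex. norm z = 1} = {}"
    using fin by (metis connected_finite_iff_sing)
  moreover have "1 \<in> {z::complex. norm z = 1}" "-1 \<in> {z::complex. norm z = 1}" by auto
  ultimately have "(1::complex) = -1" by (metis empty_iff singletonD)
  then show False by simp
qed

lemma poly_eq_on_infinite:
  fixes p q :: "'a::idom poly"
  assumes "infinite S" "\<And>z. z \<in> S \<Longrightarrow> poly p z = poly q z"
  shows "p = q"
proof (rule ccontr)
  assume "p \<noteq> q"
  then have "finite {z. poly (p - q) z = 0}" by (intro poly_roots_finite) simp
  moreover have "S \<subseteq> {z. poly (p - q) z = 0}" using assms(2) by auto
  ultimately show False using assms(1) finite_subset by blast
qed

lemma poly_eq_on_circle:
  assumes "\<And>z::complex. norm z = 1 \<Longrightarrow> poly p z = poly q z"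
  shows "p = q"
  using infinite_circle assms by (rule poly_eq_on_infinite) auto

text \<open>Numerator and denominator of a Blaschke product in lowest terms. Comparing norms instead
  of dividing avoids case distinctions at poles.\<close>

definition inner_pair :: "complex poly \<Rightarrow> complex poly \<Rightarrow> bool" where
  "inner_pair p q \<longleftrightarrow> coprime p q \<and> max (degree p) (degree q) \<ge> 1 \<and>
     (\<forall>z. norm z < 1 \<longrightarrow> norm (poly p z) < norm (poly q z)) \<and>
     (\<forall>z. norm z = 1 \<longrightarrow> norm (poly p z) = norm (poly q z))"

text \<open>On the circle both sides are z^n times |p|^2 = |q|^2, and a polynomial is determined by
  its values there. For f = p/q this is the symmetry f(1 / cnj z) = 1 / cnj (f z) without
  denominators.\<close>

lemma inner_reflection:
  assumes "inner_pair p q" "max (degree p) (degree q) = n"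
  shows "p * reflect n p = q * reflect n q"
proof (rule poly_eq_on_circle)
  fix z :: complex assume z: "norm z = 1"
  have "poly p z * cnj (poly p z) = poly q z * cnj (poly q z)"
    using assms(1) z by (simp add: inner_pair_def flip: complex_norm_square)
  then show "poly (p * reflect n p) z = poly (q * reflect n q) z"
    using assms(2) z by (auto simp: poly_reflect_circle)
qed

lemma norm_less_of_mult_eq:
  fixes a b c d :: complex
  assumes "a * b = c * d" "norm b < norm d" "\<not> (a = 0 \<and> c = 0)"
  shows "norm c < norm a"
proof -
  have "norm a * norm b = norm c * norm d" using assms(1) by (metis norm_mult)
  moreover have "norm a > 0"
    using assms by auto
  moreover have "norm d > 0" using assms(2) by (meson le_less_trans norm_ge_zero)
  ultimately have "norm c * norm d < norm a * norm d"
    using assms(2) by (metis mult_strict_left_mono)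
  then show ?thesis using \<open>norm d > 0\<close> by simp
qed

text \<open>The mirror point 1 / cnj z lies in the disc, and \<open>inner_reflection\<close>
  reverses the inequality that holds there.\<close>

lemma inner_outside:
  assumes "inner_pair p q" "norm z > 1"
  shows "norm (poly q z) < norm (poly p z)"
proof -
  define n where "n = max (degree p) (degree q)"
  have z: "z \<noteq> 0" using assms(2) by auto
  define w where "w = 1 / cnj z"
  have "norm w < 1" using assms(2) by (simp add: w_def norm_divide divide_less_eq_1)
  then have "norm (poly p w) < norm (poly q w)" using assms(1) by (simp add: inner_pair_def)
  then have "norm (poly (reflect n p) z) < norm (poly (reflect n q) z)"
    using z by (simp add: poly_reflect n_def norm_mult norm_power flip: w_def)
  moreover have "poly p z * poly (reflect n p) z = poly q z * poly (reflect n q) z"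
    using inner_reflection[OF assms(1) n_def[symmetric]] by (metis poly_mult)
  ultimately show ?thesis
    using assms(1) norm_less_of_mult_eq[of "poly p z" _ "poly q z"]
    by (auto simp: inner_pair_def coprime_poly_iff)
qed

text \<open>The case of the mirror points 0 and infinity: the coefficient at \<open>n\<close> stands
  for the value at infinity.\<close>

lemma inner_infinity:
  assumes "inner_pair p q" "n = max (degree p) (degree q)"
  shows "norm (coeff q n) < norm (coeff p n)"
proof -
  have "coeff p n * coeff (reflect n p) n = coeff q n * coeff (reflect n q) n"
    using inner_reflection[OF assms(1) assms(2)[symmetric]] coeff_mult_le[of p n "reflect n p" n]
      coeff_mult_le[of q n "reflect n q" n] degree_reflect assms(2) by simp
  moreover have "norm (poly p 0) < norm (poly q 0)" using assms(1) by (simp add: inner_pair_def)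
  then have "norm (coeff (reflect n p) n) < norm (coeff (reflect n q) n)"
    by (simp add: coeff_reflect poly_0_coeff_0)
  ultimately show ?thesis
    using assms coeff_max_nz[of p q n] norm_less_of_mult_eq[of "coeff p n" _ "coeff q n"]
    by (auto simp: inner_pair_def)
qed

lemma inner_iff:
  assumes "inner_pair p q"
  shows "norm (poly p z) < norm (poly q z) \<longleftrightarrow> norm z < 1"
    and "norm (poly p z) = norm (poly q z) \<longleftrightarrow> norm z = 1"
proof -
  consider "norm z < 1" "norm (poly p z) < norm (poly q z)"
    | "norm z = 1" "norm (poly p z) = norm (poly q z)"
    | "norm z > 1" "norm (poly q z) < norm (poly p z)"
    using inner_outside[OF assms, of z] assms unfolding inner_pair_def
    by (meson less_linear)
  then show "norm (poly p z) < norm (poly q z) \<longleftrightarrow> norm z < 1"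
    and "norm (poly p z) = norm (poly q z) \<longleftrightarrow> norm z = 1"
    by (cases; simp)+
qed

text \<open>By \<open>inner_infinity\<close> the polynomial \<open>p - smult c q\<close> has
  positive degree, hence a root; \<open>inner_iff\<close> locates it.\<close>

lemma inner_surj:
  assumes "inner_pair p q" "norm c \<le> 1"
  obtains z where "poly p z = c * poly q z" "poly q z \<noteq> 0"
    "norm z < 1 \<longleftrightarrow> norm c < 1" "norm z = 1 \<longleftrightarrow> norm c = 1"
proof -
  define n where "n = max (degree p) (degree q)"
  have "norm (c * coeff q n) \<le> norm (coeff q n)"
    using assms(2) by (simp add: norm_mult mult_left_le_one_le)
  then have "coeff (p - smult c q) n \<noteq> 0"
    using inner_infinity[OF assms(1) n_def] by auto
  then have "degree (p - smult c q) \<noteq> 0"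
    using assms(1) le_degree[of "p - smult c q" n] by (auto simp: inner_pair_def n_def)
  then have "\<not> (\<exists>a l. a \<noteq> 0 \<and> l = 0 \<and> p - smult c q = pCons a l)" by auto
  then obtain z where "poly (p - smult c q) z = 0"
    using fundamental_theorem_of_algebra_alt by blast
  then have z: "poly p z = c * poly q z" by simp
  moreover have nz: "poly q z \<noteq> 0" using z assms(1) by (auto simp: inner_pair_def coprime_poly_iff)
  ultimately show ?thesis
    using inner_iff[OF assms(1), of z] that[of z] by (auto simp: norm_mult)
qed

section \<open>Proper self-maps of the disc in the sphere and in the plane\<close>

lemma homeomorphic_Some_disc:
  obtains g where "homeomorphic_maps (top_of_set (ball 0 1)) (subtopology riemann_sphere disc) Some g"
proof -
  have "homeomorphic_map euclidean (subtopology riemann_sphere (range Some)) (Some :: complex \<Rightarrow> _)"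
    using embedding_map_Some[of "euclidean :: complex topology"]
    by (simp add: embedding_map_def riemann_sphere_def)
  then have "homeomorphic_map (top_of_set (ball 0 1))
      (subtopology (subtopology riemann_sphere (range Some)) disc) Some"
    by (rule homeomorphic_map_subtopologies) (auto simp: disc_def riemann_sphere_def)
  moreover have "range Some \<inter> disc = disc" by (auto simp: disc_def)
  ultimately show ?thesis
    using that by (auto simp: subtopology_subtopology homeomorphic_map_maps)
qed

lemma topspace_disc: "topspace (subtopology riemann_sphere disc) = disc"
  by (auto simp: riemann_sphere_def disc_def)

lemma proper_map_cong:
  assumes "proper_map X Y f" "\<And>x. x \<in> topspace X \<Longrightarrow> f x = g x"
  shows "proper_map X Y g"
proof -
  have "{x \<in> topspace X. g x = y} = {x \<in> topspace X. f x = y}" for y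
    using assms(2) by auto
  moreover have "f ` S = g ` S" if "closedin X S" for S
    using assms(2) closedin_subset[OF that] by (intro image_cong) auto
  ultimately show ?thesis using assms(1) by (simp add: proper_map_def closed_map_def)
qed

lemma proper_map_disc_iff:
  assumes "\<And>z. z \<in> ball 0 1 \<Longrightarrow> f (Some z) = Some (h z)" "h ` ball 0 1 \<subseteq> ball 0 1"
  shows "proper_map (subtopology riemann_sphere disc) (subtopology riemann_sphere disc) f \<longleftrightarrow>
    proper_map (top_of_set (ball 0 1)) (top_of_set (ball 0 1)) h"
proof -
  let ?X = "top_of_set (ball (0::complex) 1)" and ?S = "subtopology riemann_sphere disc"
  obtain g where g: "homeomorphic_maps ?X ?S Some g" by (rule homeomorphic_Some_disc)
  then have gS: "\<And>z. z \<in> ball 0 1 \<Longrightarrow> g (Some z) = z"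
    by (auto simp: homeomorphic_maps_def)
  have pS: "proper_map ?X ?S Some" and pg: "proper_map ?S ?X g"
    using g by (auto simp: homeomorphic_maps_map intro: homeomorphic_imp_proper_map)
  show ?thesis
  proof
    assume "proper_map ?S ?S f"
    then have "proper_map ?X ?X (g \<circ> (f \<circ> Some))"
      using pS pg by (intro proper_map_compose)
    then show "proper_map ?X ?X h"
      by (rule proper_map_cong) (use assms gS in \<open>auto simp: image_subset_iff\<close>)
  next
    assume "proper_map ?X ?X h"
    then have "proper_map ?S ?S (Some \<circ> (h \<circ> g))"
      using pS pg by (intro proper_map_compose)
    then show "proper_map ?S ?S f"
      by (rule proper_map_cong) (use assms gS in \<open>auto simp: topspace_disc disc_def\<close>)
  qed
qed

lemma rat_map_Some: "rat_map p q (Some z) = (if poly q z = 0 then None else Some (poly p z / poly q z))"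
  by (simp add: rat_map_def)

text \<open>Properness comes from compactness: p/q is continuous on the closed disc, hence proper
  into the plane, and it stays proper when restricted to the preimage of the open disc, which is the
  open disc.\<close>

lemma inner_imp_blaschke:
  assumes "inner_pair p q"
  shows "blaschke_product (rat_map p q)"
proof -
  define h where "h z = poly p z / poly q z" for z
  have cop: "coprime p q" using assms by (simp add: inner_pair_def)
  have q_nz: "poly q z \<noteq> 0" if "norm z \<le> 1" for z
    using inner_iff[OF assms, of z] that cop
    by (cases "norm z = 1") (auto simp: coprime_poly_iff)
  have rm: "rat_map p q (Some z) = Some (h z)" if "z \<in> ball 0 1" for z
    using that q_nz by (simp add: rat_map_Some h_def)
  have h_lt: "norm (h z) < 1 \<longleftrightarrow> norm z < 1" if "norm z \<le> 1" for z
    using inner_iff(1)[OF assms, of z] q_nz[OF that] by (simp add: h_def norm_divide)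
  have "\<exists>z. norm z < 1 \<and> h z = c" if "norm c < 1" for c
  proof -
    have "norm c \<le> 1" using that by simp
    from inner_surj[OF assms this] obtain z where "poly p z = c * poly q z" "poly q z \<noteq> 0"
      "norm z < 1 \<longleftrightarrow> norm c < 1" by metis
    then show ?thesis using that by (auto simp: h_def intro!: exI[of _ z])
  qed
  then have img: "h ` ball 0 1 = ball 0 1" using h_lt by force
  have "proper_map (top_of_set (cball 0 1)) euclidean h"
  proof (rule continuous_imp_proper_map)
    show "continuous_map (top_of_set (cball 0 1)) euclidean h"
      using q_nz by (auto simp: h_def intro!: continuous_intros)
  qed (auto simp: compact_space_subtopology Hausdorff_imp_kc_space)
  then have "proper_map (subtopology (top_of_set (cball 0 1)) (ball 0 1)) (top_of_set (ball 0 1)) h"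
    by (rule proper_map_restriction) (use h_lt in auto)
  then have "proper_map (top_of_set (ball 0 1)) (top_of_set (ball 0 1)) h"
    by (simp add: subtopology_subtopology Int_absorb1 ball_subset_cball)
  then have "proper_map (subtopology riemann_sphere disc) (subtopology riemann_sphere disc) (rat_map p q)"
    using proper_map_disc_iff[of "rat_map p q" h] rm img by blast
  moreover have "rat_map p q ` disc = disc"
    using img rm unfolding disc_def image_image by (metis (no_types, lifting) image_cong image_image)
  moreover have "rational_map (rat_map p q)" using cop by (auto simp: rational_map_def)
  moreover have "rat_degree (rat_map p q) \<ge> 1"
    using assms by (simp add: rat_degree_rat_map cop) (simp add: inner_pair_def)
  ultimately show ?thesis by (simp add: blaschke_product_def)
qed

text \<open>Properness forces |p| = |q| on the circle: if |h(z)| < r < 1 at a boundary point z, the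
  preimage of the closed disc of radius r, compact in the open disc, would accumulate at z.\<close>

lemma blaschke_imp_inner:
  assumes "blaschke_product A"
  obtains p q where "A = rat_map p q" "inner_pair p q"
proof -
  obtain p q where A: "A = rat_map p q" and cop: "coprime p q"
    using assms by (auto simp: blaschke_product_def rational_map_def)
  have deg: "max (degree p) (degree q) \<ge> 1"
    using assms by (simp add: blaschke_product_def A rat_degree_rat_map cop)
  define h where "h z = poly p z / poly q z" for z
  have img: "rat_map p q ` disc = disc" using assms by (simp add: blaschke_product_def A)
  have *: "poly q z \<noteq> 0 \<and> norm (h z) < 1" if "norm z < 1" for z
  proof -
    have "rat_map p q (Some z) \<in> disc" using img that by (auto simp: disc_def)
    then show ?thesis by (auto simp: disc_def rat_map_Some h_def split: if_splits)
  qed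
  have inD: "norm (poly p z) < norm (poly q z)" if "norm z < 1" for z
    using *[OF that] by (auto simp: h_def norm_divide divide_less_eq_1)
  have le: "norm (poly p z) \<le> norm (poly q z)" if "norm z \<le> 1" for z
  proof -
    have z: "z \<in> closure (ball 0 1)" using that by simp
    have "continuous_on (closure (ball 0 1)) (\<lambda>z. norm (poly q z) - norm (poly p z))"
      by (intro continuous_intros)
    from continuous_ge_on_closure[OF this z, of 0]
    have "0 \<le> norm (poly q z) - norm (poly p z)"
      using inD by (simp add: less_imp_le)
    then show ?thesis by simp
  qed
  have q_nz: "poly q z \<noteq> 0" if "norm z \<le> 1" for z
    using le[OF that] cop by (auto simp: coprime_poly_iff)
  have proper: "proper_map (top_of_set (ball 0 1)) (top_of_set (ball 0 1)) h"
    using assms * by (subst proper_map_disc_iff[symmetric, of "rat_map p q"])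
      (auto simp: rat_map_Some h_def blaschke_product_def A)
  have "norm (poly p z) = norm (poly q z)" if z: "norm z = 1" for z
  proof (rule ccontr)
    assume "norm (poly p z) \<noteq> norm (poly q z)"
    then have "norm (h z) < 1" using le[of z] q_nz[of z] z by (simp add: h_def norm_divide)
    then obtain r where r: "norm (h z) < r" "r < 1" using dense by blast
    define C where "C = {w \<in> ball 0 1. h w \<in> cball 0 r}"
    have "compactin (top_of_set (ball (0::complex) 1)) (cball 0 r)"
      using r by (auto simp: compactin_subtopology)
    from compactin_proper_map_preimage[OF proper this] have "compact C"
      by (simp add: C_def compactin_subtopology)
    then have cl: "closed C" by (rule compact_imp_closed)
    have "continuous_on (cball 0 1) h" using q_nz by (auto simp: h_def intro!: continuous_intros)
    then have tend: "(h \<longlongrightarrow> h z) (at z within cball 0 1)" using z by (auto simp: continuous_on_def)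
    have "\<forall>\<^sub>F w in at z within ball 0 1. h w \<in> ball 0 r"
    proof -
      have "\<forall>\<^sub>F w in at z within cball 0 1. h w \<in> ball 0 r"
        using r by (intro topological_tendstoD[OF tend]) auto
      then show ?thesis using at_le[OF ball_subset_cball] filter_leD by blast
    qed
    then have ev: "\<forall>\<^sub>F w in at z within ball 0 1. w \<in> C"
      by (auto simp: C_def eventually_at_filter elim!: eventually_mono)
    have "z islimpt ball 0 1" using z by (simp add: islimpt_ball)
    then have "at z within ball 0 1 \<noteq> bot" by (simp add: trivial_limit_within)
    then have "z \<in> C" by (intro Lim_in_closed_set[OF cl ev _ tendsto_ident_at])
    then show False using z by (simp add: C_def)
  qed
  then have "inner_pair p q" using cop deg inD by (simp add: inner_pair_def)
  then show ?thesis using that A by blast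
qed

section \<open>The field of functions with rational welding\<close>

lemma proportional:
  fixes x y x' y' :: "'a::field"
  assumes "\<not> (x = 0 \<and> y = 0)" "x * y' = x' * y"
  obtains c where "x' = c * x" "y' = c * y"
proof (cases "x = 0")
  case True
  then show ?thesis using assms that[of "y' / y"] by auto
next
  case False
  then show ?thesis using assms that[of "x' / x"] by (auto simp: field_simps)
qed

text \<open>The circle is connected with more than one point, hence perfect, so removing a finite
  set leaves a dense subset.\<close>

lemma continuous_zero_on_circle:
  fixes f :: "complex \<Rightarrow> complex"
  assumes "finite F" "continuous_on (sphere 0 1) f"
    and "\<And>z. z \<in> sphere 0 1 - F \<Longrightarrow> f z = 0" and "w \<in> sphere 0 1"
  shows "f w = 0"
proof -
  have "\<not> (\<exists>x. sphere (0::complex) 1 = {x})"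
  proof
    assume "\<exists>x. sphere (0::complex) 1 = {x}"
    moreover have "1 \<in> sphere (0::complex) 1" "-1 \<in> sphere (0::complex) 1" by auto
    ultimately have "(1::complex) = -1" by (metis singletonD)
    then show False by simp
  qed
  moreover have "connected (sphere (0::complex) 1)" by (rule connected_sphere) simp
  ultimately have "w islimpt sphere 0 1"
    using assms(4) connected_imp_perfect by blast
  then have "w islimpt (sphere 0 1 - F)"
    using assms(1) by (metis islimpt_Un_finite Un_Diff_cancel Un_commute)
  moreover have "closed {z \<in> sphere 0 1. f z = 0}"
    using continuous_closed_preimage_constant[OF assms(2) closed_sphere, of 0] by simp
  moreover have "sphere 0 1 - F \<subseteq> {z \<in> sphere 0 1. f z = 0}" using assms(3) by auto
  ultimately show ?thesis
    using closed_limpt islimpt_subset by blast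
qed

locale circle_homeomorphism =
  fixes k k' :: "complex \<Rightarrow> complex"
  assumes homeo: "homeomorphism (sphere 0 1) (sphere 0 1) k k'"
begin

lemma image_k: "k ` sphere 0 1 = sphere 0 1"
  using homeo by (rule homeomorphism_image1)

lemma k_norm: "norm z = 1 \<Longrightarrow> norm (k z) = 1"
  using image_k imageI[of z "sphere 0 1" k] by simp

lemma k_surj:
  assumes "norm w = 1"
  obtains z where "norm z = 1" "k z = w"
proof -
  have "w \<in> k ` sphere 0 1" using assms image_k by simp
  then show ?thesis using that by auto
qed

lemma k_inj: "inj_on k (sphere 0 1)"
  by (rule inj_on_inverseI[where g = k']) (rule homeomorphism_apply1[OF homeo])

lemma poly_eq_comp:
  assumes "\<And>z. norm z = 1 \<Longrightarrow> poly p (k z) = poly q (k z)"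
  shows "p = q"
proof (rule poly_eq_on_circle)
  fix w :: complex assume "norm w = 1"
  then obtain z where "norm z = 1" "k z = w" by (rule k_surj)
  then show "poly p w = poly q w" using assms by blast
qed

text \<open>As \<open>k\<close> is merely a homeomorphism, cancellation is topological: injectivity
  of \<open>k\<close> leaves only finitely many zeros of the first two factors on the circle, and
  continuity carries \<open>f = 0\<close> across them.\<close>

lemma cancel_on_circle:
  assumes "continuous_on (sphere 0 1) f" "s \<noteq> 0" "c \<noteq> 0"
    and "\<And>z. norm z = 1 \<Longrightarrow> poly c (k z) * poly s z * f z = 0" and "norm w = 1"
  shows "f w = 0"
proof (rule continuous_zero_on_circle[where f = f and w = w])
  show "finite ({z. poly s z = 0} \<union> (k -` {z. poly c z = 0} \<inter> sphere 0 1))"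
    using assms(2,3) k_inj by (intro finite_UnI finite_vimage_IntI poly_roots_finite)
  show "continuous_on (sphere 0 1) f" by fact
  show "w \<in> sphere 0 1" using assms(5) by simp
qed (use assms(4) in auto)

lemma continuous_poly_comp: "continuous_on (sphere 0 1) (\<lambda>z. poly p (k z))"
  using homeomorphism_cont1[OF homeo] by (intro continuous_intros)

text \<open>Cross-multiplication states F o k = r/s on the circle without excluding poles. Fractions
  need not be in lowest terms, which makes closure under sums and products direct.\<close>

definition weld_field :: "complex poly fract set" where
  "weld_field = {Fract p q | p q. q \<noteq> 0 \<and> (\<exists>r s. s \<noteq> 0 \<and>
     (\<forall>z. norm z = 1 \<longrightarrow> poly p (k z) * poly s z = poly r z * poly q (k z)))}"

lemma weld_fieldI:
  assumes "q \<noteq> 0" "s \<noteq> 0"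
    and "\<And>z. norm z = 1 \<Longrightarrow> poly p (k z) * poly s z = poly r z * poly q (k z)"
  shows "Fract p q \<in> weld_field"
  using assms unfolding weld_field_def by blast

lemma weld_fieldE:
  assumes "x \<in> weld_field"
  obtains p q r s where "x = Fract p q" "q \<noteq> 0" "s \<noteq> 0"
    "\<And>z. norm z = 1 \<Longrightarrow> poly p (k z) * poly s z = poly r z * poly q (k z)"
  using assms unfolding weld_field_def by blast

sublocale W: function_field weld_field
proof
  show "to_fract [:c:] \<in> weld_field" for c
    unfolding to_fract_def by (rule weld_fieldI[where r = "[:c:]" and s = 1]) auto
  fix x assume "x \<in> weld_field"
  then obtain p q r s where x: "x = Fract p q" "q \<noteq> 0" "s \<noteq> 0"
      "\<And>z. norm z = 1 \<Longrightarrow> poly p (k z) * poly s z = poly r z * poly q (k z)"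
    by (rule weld_fieldE) metis
  show "inverse x \<in> weld_field"
  proof (cases "p = 0")
    case True
    then have "inverse x = Fract 0 1" using x by (simp add: fract_collapse)
    also have "\<dots> \<in> weld_field" by (rule weld_fieldI[where r = 0 and s = 1]) auto
    finally show ?thesis .
  next
    case False
    \<comment> \<open>Otherwise p o k vanishes off the zeros of \<open>s\<close>, hence on the whole
      circle, and \<open>p\<close> would be 0.\<close>
    have "r \<noteq> 0"
    proof
      assume r: "r = 0"
      have "poly p (k w) = 0" if "norm w = 1" for w
        by (rule cancel_on_circle[OF continuous_poly_comp x(3), of 1 p])
          (use x(4) r that in \<open>auto simp: mult.commute\<close>)
      then have "p = 0" by (intro poly_eq_comp) simp
      then show False using False by simp
    qed
    then have "Fract q p \<in> weld_field"
      using False x by (intro weld_fieldI[where r = s and s = r]) (auto simp: mult.commute)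
    then show ?thesis by (simp add: x(1))
  qed
  fix y assume "y \<in> weld_field"
  then obtain p' q' r' s' where y: "y = Fract p' q'" "q' \<noteq> 0" "s' \<noteq> 0"
      "\<And>z. norm z = 1 \<Longrightarrow> poly p' (k z) * poly s' z = poly r' z * poly q' (k z)"
    by (rule weld_fieldE) metis
  have "Fract (p * p') (q * q') \<in> weld_field"
  proof (rule weld_fieldI[where r = "r * r'" and s = "s * s'"])
    fix z :: complex assume z: "norm z = 1"
    have "poly (p * p') (k z) * poly (s * s') z
        = (poly p (k z) * poly s z) * (poly p' (k z) * poly s' z)"
      by simp
    then show "poly (p * p') (k z) * poly (s * s') z = poly (r * r') z * poly (q * q') (k z)"
      by (simp add: x(4)[OF z] y(4)[OF z])
  qed (use x y in auto)
  then show "x * y \<in> weld_field" by (simp add: x(1) y(1))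
  have "Fract (p * q' + p' * q) (q * q') \<in> weld_field"
  proof (rule weld_fieldI[where r = "r * s' + r' * s" and s = "s * s'"])
    fix z :: complex assume z: "norm z = 1"
    have "poly (p * q' + p' * q) (k z) * poly (s * s') z
        = (poly p (k z) * poly s z) * (poly q' (k z) * poly s' z)
          + (poly p' (k z) * poly s' z) * (poly q (k z) * poly s z)"
      by (simp add: algebra_simps)
    also have "\<dots> = poly (r * s' + r' * s) z * poly (q * q') (k z)"
      by (simp only: x(4)[OF z] y(4)[OF z]) (simp add: algebra_simps)
    finally show "poly (p * q' + p' * q) (k z) * poly (s * s') z
        = poly (r * s' + r' * s) z * poly (q * q') (k z)" .
  qed (use x y in auto)
  then show "x + y \<in> weld_field" by (simp add: x(1,2) y(1,2))
qed

text \<open>Passing to lowest terms on both sides removes a factor \<open>c\<close> composed with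
  \<open>k\<close> and a factor \<open>g\<close>; \<open>cancel_on_circle\<close> permits
  this.\<close>

lemma weld_reduced:
  assumes "coprime p q" "q \<noteq> 0" "Fract p q \<in> weld_field"
  obtains v w where "coprime v w"
    "\<And>z. norm z = 1 \<Longrightarrow> poly p (k z) * poly w z = poly v z * poly q (k z)"
proof -
  obtain p1 q1 r1 s1 where 1: "Fract p q = Fract p1 q1" "q1 \<noteq> 0" "s1 \<noteq> 0"
      "\<And>z. norm z = 1 \<Longrightarrow> poly p1 (k z) * poly s1 z = poly r1 z * poly q1 (k z)"
    using assms(3) by (rule weld_fieldE) metis
  have "p * q1 = p1 * q" using 1 assms(2) by (simp add: eq_fract)
  with assms(1) obtain c where c: "p1 = p * c" "q1 = q * c" by (rule coprime_cross_dvd)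
  have "gcd r1 s1 \<noteq> 0" using 1 by simp
  then obtain v w g where vw: "r1 = v * g" "s1 = w * g" "coprime v w"
    using gcd_coprime_exists by blast
  have nz: "c \<noteq> 0" "g \<noteq> 0" using c vw 1 by auto
  have "poly p (k z) * poly w z - poly v z * poly q (k z) = 0" if z: "norm z = 1" for z
  proof (rule cancel_on_circle[OF _ nz(2,1) _ z])
    show "continuous_on (sphere 0 1) (\<lambda>z. poly p (k z) * poly w z - poly v z * poly q (k z))"
      by (intro continuous_intros continuous_poly_comp)
    show "poly c (k z) * poly g z * (poly p (k z) * poly w z - poly v z * poly q (k z)) = 0"
      if "norm z = 1" for z
      using 1(4)[OF that] by (simp add: c vw algebra_simps)
  qed
  then show ?thesis using that[OF vw(3)] by simp
qed

lemma reflect_eq_0: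
  assumes "degree p \<le> n" "reflect n p = 0"
  shows "p = 0"
proof (rule poly_eq_on_circle)
  fix z :: complex assume z: "norm z = 1"
  then have "z \<noteq> 0" by auto
  then show "poly p z = poly 0 z" using poly_reflect_circle[OF assms(1) z] assms(2) by simp
qed

text \<open>On the circle reflection is conjugation up to a power of the variable. Since
  \<open>k\<close> preserves the circle, conjugating the welding relation yields one for the
  reflections, with equal powers on both sides.\<close>

lemma weld_reflect:
  assumes "Fract p q \<in> weld_field" "q \<noteq> 0" "degree p \<le> n" "degree q \<le> n"
  shows "Fract (reflect n p) (reflect n q) \<in> weld_field"
proof -
  obtain p1 q1 r1 s1 where 1: "Fract p q = Fract p1 q1" "q1 \<noteq> 0" "s1 \<noteq> 0"
      "\<And>z. norm z = 1 \<Longrightarrow> poly p1 (k z) * poly s1 z = poly r1 z * poly q1 (k z)"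
    using assms(1) by (rule weld_fieldE) metis
  have cross: "p * q1 = p1 * q" using 1 assms(2) by (simp add: eq_fract)
  define m where "m = max (degree p1) (degree q1)"
  define l where "l = max (degree r1) (degree s1)"
  have reflect_cross: "reflect n p * reflect m q1 = reflect m p1 * reflect n q"
  proof (rule poly_eq_on_circle)
    fix z :: complex assume z: "norm z = 1"
    have "cnj (poly p z) * cnj (poly q1 z) = cnj (poly p1 z) * cnj (poly q z)"
      using cross by (metis complex_cnj_mult poly_mult)
    then show "poly (reflect n p * reflect m q1) z = poly (reflect m p1 * reflect n q) z"
      using z assms by (simp add: poly_reflect_circle m_def)
  qed
  have nz: "reflect n q \<noteq> 0" "reflect m q1 \<noteq> 0" "reflect l s1 \<noteq> 0"
    using reflect_eq_0[of q n] reflect_eq_0[of q1 m] reflect_eq_0[of s1 l] assms(2,4) 1(2,3)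
    by (auto simp: m_def l_def)
  have "Fract (reflect m p1) (reflect m q1) \<in> weld_field"
  proof (rule weld_fieldI[OF nz(2,3)])
    fix z :: complex assume z: "norm z = 1"
    have "cnj (poly p1 (k z)) * cnj (poly s1 z) = cnj (poly r1 z) * cnj (poly q1 (k z))"
      using 1(4)[OF z] by (metis complex_cnj_mult)
    then show "poly (reflect m p1) (k z) * poly (reflect l s1) z = poly (reflect l r1) z * poly (reflect m q1) (k z)"
      using z k_norm[OF z] by (simp add: poly_reflect_circle m_def l_def)
  qed
  moreover have "Fract (reflect n p) (reflect n q) = Fract (reflect m p1) (reflect m q1)"
    using reflect_cross nz by (simp add: eq_fract)
  ultimately show ?thesis by simp
qed

end

section \<open>Blaschke products from polynomials with all zeros in the disc\<close>

lemma moebius_denominator: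
  fixes z s :: complex
  assumes "norm z < 1" "norm s < 1"
  shows "norm (z - s) < norm (1 - cnj s * z)"
proof -
  have "(norm (1 - cnj s * z))\<^sup>2 - (norm (z - s))\<^sup>2 = (1 - (norm s)\<^sup>2) * (1 - (norm z)\<^sup>2)"
    by (simp only: cmod_power2) (simp add: power2_eq_square algebra_simps)
  moreover have "(norm s)\<^sup>2 < 1" "(norm z)\<^sup>2 < 1"
    using assms by (simp_all add: power_less_one_iff)
  ultimately have "(norm (z - s))\<^sup>2 < (norm (1 - cnj s * z))\<^sup>2"
    by (smt (verit) mult_pos_pos)
  then show ?thesis by (rule power_less_imp_less_base) simp
qed

text \<open>Induction splits off one Blaschke factor (z - s) / (1 - cnj s z) at a time. The weak
  inequality carries the induction from degree 0, where equality holds.\<close>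

lemma norm_le_reflect:
  assumes "degree x = n" "\<And>t. poly x t = 0 \<Longrightarrow> norm t < 1" "norm z < 1"
  shows "poly (reflect n x) z \<noteq> 0 \<and> norm (poly x z) \<le> norm (poly (reflect n x) z) \<and>
    (n \<ge> 1 \<longrightarrow> norm (poly x z) < norm (poly (reflect n x) z))"
  using assms(1,2)
proof (induction n arbitrary: x)
  case 0
  then obtain c where c: "x = [:c:]" by (auto elim!: degree_eq_zeroE)
  \<comment> \<open>The zero polynomial would have the root 2, outside the disc.\<close>
  then have "c \<noteq> 0" using "0.prems"(2)[of 2] by auto
  then show ?case using c by (simp add: reflect_def monom_0)
next
  case (Suc n)
  then have "\<not> (\<exists>a l. a \<noteq> 0 \<and> l = 0 \<and> x = pCons a l)" by auto
  then obtain s where "poly x s = 0" using fundamental_theorem_of_algebra_alt by blast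
  then obtain x' where x': "x = [:- s, 1:] * x'" by (auto simp: poly_eq_0_iff_dvd elim!: dvdE)
  have s: "norm s < 1" using Suc.prems(2) \<open>poly x s = 0\<close> by blast
  have "x' \<noteq> 0" using Suc.prems(1) x' by auto
  then have "degree x = 1 + degree x'" unfolding x' by (subst degree_mult_eq) auto
  then have deg: "degree x' = n" using Suc.prems(1) by simp
  have roots: "norm t < 1" if "poly x' t = 0" for t
    using Suc.prems(2)[of t] that by (simp add: x')
  note IH = Suc.IH[OF deg roots]
  have "reflect (Suc n) x = [:1, - cnj s:] * reflect n x'"
  proof (rule poly_eq_on_circle)
    fix u :: complex assume u: "norm u = 1"
    have "u * cnj u = 1" using complex_norm_square[of u] u by simp
    then have "u * cnj (u - s) = 1 - cnj s * u" by (simp add: algebra_simps)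
    then show "poly (reflect (Suc n) x) u = poly ([:1, - cnj s:] * reflect n x') u"
      using u deg Suc.prems(1) poly_reflect_circle[of x' n u] poly_reflect_circle[of x "Suc n" u]
      by (simp add: x' algebra_simps)
  qed
  then have "poly (reflect (Suc n) x) z = (1 - cnj s * z) * poly (reflect n x') z"
    by (simp add: algebra_simps)
  moreover have "poly x z = (z - s) * poly x' z" by (simp add: x' algebra_simps)
  moreover have m: "norm (z - s) < norm (1 - cnj s * z)"
    using moebius_denominator assms(3) s by blast
  moreover have "norm (z - s) * norm (poly x' z) < norm (1 - cnj s * z) * norm (poly (reflect n x') z)"
  proof -
    have "norm (z - s) * norm (poly x' z) \<le> norm (z - s) * norm (poly (reflect n x') z)"
      using IH by (intro mult_left_mono) auto
    also have "\<dots> < norm (1 - cnj s * z) * norm (poly (reflect n x') z)"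
      using IH m by simp
    finally show ?thesis .
  qed
  ultimately show ?case using IH by (auto simp: norm_mult)
qed

lemma inner_pair_reflect:
  assumes "degree x = n" "n \<ge> 1" "\<And>t. poly x t = 0 \<Longrightarrow> norm t < 1"
  shows "inner_pair x (reflect n x)"
  unfolding inner_pair_def
proof (intro conjI allI impI)
  show "coprime x (reflect n x)"
    unfolding coprime_poly_iff using assms(3) norm_le_reflect[OF assms(1,3)] by blast
  show "1 \<le> max (degree x) (degree (reflect n x))" using assms by simp
  fix z :: complex
  show "norm (poly x z) < norm (poly (reflect n x) z)" if "norm z < 1"
    using norm_le_reflect[OF assms(1,3) that] assms(2) by blast
  show "norm (poly x z) = norm (poly (reflect n x) z)" if "norm z = 1"
    using that assms(1) by (simp add: poly_reflect_circle norm_mult norm_power)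
qed

section \<open>Uniqueness of minimal solutions\<close>

context minimal_generator
begin

lemma moebius_mem: "Fract (smult \<alpha> a + smult \<beta> b) (smult \<gamma> a + smult \<delta> b) \<in> K"
proof -
  have *: "to_fract (smult \<alpha> a + smult \<beta> b)
      = to_fract b * (to_fract [:\<alpha>:] * Fract a b + to_fract [:\<beta>:])" for \<alpha> \<beta>
    using b_nz by (simp add: to_fract_smult Fract_conv_to_fract algebra_simps)
  have "Fract (smult \<alpha> a + smult \<beta> b) (smult \<gamma> a + smult \<delta> b)
      = (to_fract [:\<alpha>:] * Fract a b + to_fract [:\<beta>:])
        / (to_fract [:\<gamma>:] * Fract a b + to_fract [:\<delta>:])"
    unfolding Fract_conv_to_fract[of "smult \<alpha> a + smult \<beta> b"] * using b_nz by simp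
  also have "\<dots> \<in> K"
    by (intro divide_mem add_mem mult_mem const_mem mem)
  finally show ?thesis .
qed

end

context circle_homeomorphism
begin

section \<open>Solutions of the welding equation as quadruples of polynomials\<close>

definition welds :: "complex poly \<Rightarrow> complex poly \<Rightarrow> complex poly \<Rightarrow> complex poly \<Rightarrow> bool" where
  "welds p q v w \<longleftrightarrow> inner_pair p q \<and> inner_pair v w \<and>
     max (degree p) (degree q) = max (degree v) (degree w) \<and>
     (\<forall>z. norm z = 1 \<longrightarrow> poly p (k z) * poly w z = poly v z * poly q (k z))"

lemma inner_pair_denominator:
  assumes "inner_pair p q" "norm z \<le> 1"
  shows "poly q z \<noteq> 0"
proof
  assume q: "poly q z = 0"
  then have "poly p z \<noteq> 0" using assms(1) by (auto simp: inner_pair_def coprime_poly_iff)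
  then have "\<not> norm z < 1" "norm z \<noteq> 1"
    using inner_iff[OF assms(1), of z] q by auto
  then show False using assms(2) by simp
qed

lemma welding_solution_iff_welds:
  assumes "inner_pair p q" "inner_pair v w"
  shows "welding_solution k (rat_map p q) (rat_map v w) \<longleftrightarrow> welds p q v w"
proof -
  have cop: "coprime p q" "coprime v w" using assms by (auto simp: inner_pair_def)
  have "rat_map p q (Some (k z)) = rat_map v w (Some z) \<longleftrightarrow>
      poly p (k z) * poly w z = poly v z * poly q (k z)" if "norm z = 1" for z
    using inner_pair_denominator[OF assms(1), of "k z"] inner_pair_denominator[OF assms(2), of z]
      k_norm[OF that] that
    by (simp add: rat_map_Some frac_eq_eq)
  then show ?thesis
    using assms inner_imp_blaschke
    by (auto simp: welding_solution_def welds_def rat_degree_rat_map cop)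
qed

lemma welding_solutionE:
  assumes "welding_solution k A B"
  obtains p q v w where "A = rat_map p q" "B = rat_map v w" "welds p q v w"
proof -
  have "blaschke_product A" "blaschke_product B" using assms by (auto simp: welding_solution_def)
  then obtain p q v w where "A = rat_map p q" "inner_pair p q" "B = rat_map v w" "inner_pair v w"
    by (metis blaschke_imp_inner)
  then show ?thesis using that assms welding_solution_iff_welds by blast
qed

lemma welds_nz:
  assumes "welds p q v w"
  shows "q \<noteq> 0" "w \<noteq> 0"
  using inner_pair_denominator[of p q 0] inner_pair_denominator[of v w 0] assms
  by (auto simp: welds_def)

lemma welds_mem:
  assumes "welds p q v w"
  shows "Fract p q \<in> weld_field"
  using assms welds_nz[OF assms] by (intro weld_fieldI[of _ w _ v]) (auto simp: welds_def)

lemma ex_minimal_generator: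
  assumes "coprime p q" "Fract p q \<in> weld_field" "max (degree p) (degree q) \<ge> 1"
  obtains a b N where "minimal_generator weld_field a b N"
proof -
  define Q where "Q n \<longleftrightarrow> n \<ge> 1 \<and>
    (\<exists>a b. coprime a b \<and> Fract a b \<in> weld_field \<and> max (degree a) (degree b) = n)" for n
  define N where "N = (LEAST n. Q n)"
  have "Q (max (degree p) (degree q))" using assms by (auto simp: Q_def)
  then have "Q N" unfolding N_def by (rule LeastI)
  then obtain a b where ab: "coprime a b" "Fract a b \<in> weld_field" "max (degree a) (degree b) = N" "N \<ge> 1"
    by (auto simp: Q_def)
  have "minimal_generator weld_field a b N"
  proof
    fix p q :: "complex poly"
    assume "coprime p q" "Fract p q \<in> weld_field" "1 \<le> max (degree p) (degree q)"
    then have "Q (max (degree p) (degree q))" by (auto simp: Q_def)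
    then show "N \<le> max (degree p) (degree q)" unfolding N_def by (rule Least_le)
  qed (use ab in auto)
  then show ?thesis by (rule that)
qed

text \<open>The reflection of the generator is weldable of degree at most \<open>N\<close>, so by minimality
  Lueroth's theorem expresses it as a Moebius image of the generator.\<close>

lemma reflect_in_span:
  assumes "minimal_generator weld_field a b N"
  obtains \<alpha> \<beta> \<gamma> \<delta> where "reflect N a = smult \<alpha> a + smult \<beta> b" "reflect N b = smult \<gamma> a + smult \<delta> b"
proof -
  interpret G: minimal_generator weld_field a b N by fact
  have le: "degree a \<le> N" "degree b \<le> N" using G.deg by auto
  have b': "reflect N b \<noteq> 0" using reflect_eq_0[OF le(2)] G.b_nz by auto
  then have "gcd (reflect N a) (reflect N b) \<noteq> 0" by simp
  then obtain a1 b1 g where 1: "reflect N a = a1 * g" "reflect N b = b1 * g" "coprime a1 b1"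
    using gcd_coprime_exists by blast
  have nz: "b1 \<noteq> 0" "g \<noteq> 0" using 1 b' by auto
  have "Fract (reflect N a) (reflect N b) \<in> weld_field"
    using weld_reflect[OF G.mem G.b_nz le] .
  also have "Fract (reflect N a) (reflect N b) = Fract a1 b1" using b' nz by (simp add: eq_fract 1)
  finally have mem: "Fract a1 b1 \<in> weld_field" .
  \<comment> \<open>If the reflection of a/b were constant, conjugation on the circle would make a/b
    constant as well.\<close>
  have "max (degree a1) (degree b1) \<ge> 1"
  proof (rule ccontr)
    assume "\<not> ?thesis"
    then have "degree a1 = 0" "degree b1 = 0" by auto
    then obtain x y where xy: "a1 = [:x:]" "b1 = [:y:]" by (auto elim!: degree_eq_zeroE)
    have "smult (cnj y) a = smult (cnj x) b"
    proof (rule poly_eq_on_circle)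
      fix z :: complex assume z: "norm z = 1"
      then have "z \<noteq> 0" by auto
      have "reflect N a * b1 = reflect N b * a1" using 1 by simp
      then have "poly (reflect N a * b1) z = poly (reflect N b * a1) z" by simp
      then have "poly (reflect N a) z * y = poly (reflect N b) z * x"
        by (simp add: xy mult.commute)
      then have "cnj (poly a z) * y = cnj (poly b z) * x"
        using z le \<open>z \<noteq> 0\<close> by (simp add: poly_reflect_circle)
      then have "cnj (cnj (poly a z) * y) = cnj (cnj (poly b z) * x)" by simp
      then show "poly (smult (cnj y) a) z = poly (smult (cnj x) b) z" by (simp add: mult.commute)
    qed
    from pencil_dependent_imp_const[OF G.cop this] G.deg G.N nz xy show False by auto
  qed
  note ge = G.least[OF 1(3) mem this]
  obtain r s e where rs: "coprime r s" "e = max (degree r) (degree s)" "a1 = hom_subst e r a b" "b1 = hom_subst e s a b"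
    using G.lueroth[OF 1(3) mem nz(1)] by metis
  have eN: "max (degree a1) (degree b1) = e * N"
    using max_degree_hom_subst[OF rs(1,2) G.cop G.deg[symmetric]] rs by simp
  have add: "degree p + degree g \<le> N" if "p * g = reflect N q" "p \<noteq> 0" for p q
  proof -
    have "degree (p * g) \<le> N" using degree_reflect[of N q] that(1) by simp
    then show ?thesis using degree_mult_eq[OF that(2) nz(2)] by simp
  qed
  \<comment> \<open>Since \<open>N\<close> is also a lower bound for the first summand, the common
    factor \<open>g\<close> is constant, the degree is exactly \<open>N\<close>, and
    \<open>e = 1\<close> follows.\<close>
  have "max (degree a1) (degree b1) + degree g \<le> N"
    using add[of a1 a] add[of b1 b] 1 nz by (cases "a1 = 0") auto
  with ge have g0: "degree g = 0" and "max (degree a1) (degree b1) = N" by auto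
  with eN G.N have e: "e = 1" by simp
  obtain c where c: "g = [:c:]" using g0 by (auto elim!: degree_eq_zeroE)
  show ?thesis
    by (rule that[of "c * coeff r 1" "c * coeff r 0" "c * coeff s 1" "c * coeff s 0"])
      (simp_all add: 1 c rs(3,4) e hom_subst_one smult_add_right del: One_nat_def)
qed

text \<open>The fibre of a/b through a suitable point \<open>c\<close> of the disc supplies the
  zeros of the Blaschke product; its denominator is the reflection of its numerator.\<close>

lemma ex_inner_generator:
  assumes "inner_pair p q" "Fract p q \<in> weld_field"
  obtains x y N where "minimal_generator weld_field x y N" "inner_pair x y"
proof -
  have pq: "coprime p q" "max (degree p) (degree q) \<ge> 1" using assms by (auto simp: inner_pair_def)
  have q: "q \<noteq> 0" using inner_pair_denominator[OF assms(1), of 0] by auto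
  obtain a b N where "minimal_generator weld_field a b N"
    using ex_minimal_generator[OF pq(1) assms(2) pq(2)] .
  then interpret G: minimal_generator weld_field a b N .
  have le: "degree a \<le> N" "degree b \<le> N" using G.deg by auto
  \<comment> \<open>Evaluated at \<open>c\<close>, this coefficient is the coefficient of
    \<open>x\<close> at \<open>N\<close>; hence \<open>x\<close> has degree \<open>N\<close> for all
    but finitely many \<open>c\<close>.\<close>
  have "coeff (pencil a b) N \<noteq> 0"
    using degree_pencil[OF G.cop G.deg G.N] by (metis leading_coeff_0_iff)
  then have "finite {z. poly (coeff (pencil a b) N) z = 0}" by (rule poly_roots_finite)
  moreover have "infinite (ball (0::complex) 1)"
    using not_open_singleton finite_imp_not_open[of "ball (0::complex) 1"] by auto
  ultimately obtain c where c: "c \<in> ball 0 1" "poly (coeff (pencil a b) N) c \<noteq> 0"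
    by (metis (mono_tags, lifting) finite_subset mem_Collect_eq subsetI)
  define x where "x = smult (poly b c) a + smult (- poly a c) b"
  have "coeff x N \<noteq> 0" using c(2) by (simp add: x_def coeff_pencil mult.commute)
  moreover have "degree x \<le> N"
    unfolding x_def using le by (intro degree_add_le) (auto intro: order.trans[OF degree_smult_le])
  ultimately have deg: "degree x = N" by (simp add: le_antisym le_degree)
  obtain r s e where rs: "coprime r s" "e = max (degree r) (degree s)" "p = hom_subst e r a b" "q = hom_subst e s a b"
    using G.lueroth[OF pq(1) assms(2) q] by metis
  \<comment> \<open>At a root t the pair (a, b) is a multiple of its value at \<open>c\<close>. The
    forms \<open>p\<close> and \<open>q\<close> then scale by the same factor, so |p| < |q| passes
    from \<open>c\<close> to t.\<close>
  have roots: "norm t < 1" if "poly x t = 0" for t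
  proof -
    have "\<not> (poly a c = 0 \<and> poly b c = 0)" "poly a c * poly b t = poly a t * poly b c"
      using G.cop that by (auto simp: coprime_poly_iff x_def mult.commute)
    then obtain l where l: "poly a t = l * poly a c" "poly b t = l * poly b c"
      by (rule proportional)
    then have "l \<noteq> 0" using G.cop by (auto simp: coprime_poly_iff)
    have "poly p t = l ^ e * poly p c" "poly q t = l ^ e * poly q c"
      by (simp_all add: rs poly_hom_subst l form_eval_scale)
    moreover have "norm (poly p c) < norm (poly q c)" using assms(1) c(1) by (simp add: inner_pair_def)
    ultimately have "norm (poly p t) < norm (poly q t)" using \<open>l \<noteq> 0\<close> by (simp add: norm_mult)
    then show ?thesis using inner_iff(1)[OF assms(1)] by blast
  qed
  define y where "y = reflect N x"
  have inn: "inner_pair x y" unfolding y_def by (rule inner_pair_reflect[OF deg G.N roots])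
  obtain \<alpha> \<beta> \<gamma> \<delta> where span: "reflect N a = smult \<alpha> a + smult \<beta> b" "reflect N b = smult \<gamma> a + smult \<delta> b"
    using reflect_in_span[OF \<open>minimal_generator weld_field a b N\<close>] .
  define \<mu> \<nu> where "\<mu> = cnj (poly b c)" and "\<nu> = - cnj (poly a c)"
  \<comment> \<open>Reflection is conjugate-linear, so the coefficients of \<open>x\<close> reappear
    conjugated.\<close>
  have "y = smult \<mu> (reflect N a) + smult \<nu> (reflect N b)"
  proof (rule poly_eq_on_circle)
    fix z :: complex assume "norm z = 1"
    then show "poly y z = poly (smult \<mu> (reflect N a) + smult \<nu> (reflect N b)) z"
      using le deg unfolding y_def by (simp add: poly_reflect_circle) (simp add: x_def \<mu>_def \<nu>_def algebra_simps)
  qed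
  then have y: "y = smult (\<mu> * \<alpha> + \<nu> * \<gamma>) a + smult (\<mu> * \<beta> + \<nu> * \<delta>) b"
    by (simp add: span smult_add_left smult_add_right)
  \<comment> \<open>Minimality of \<open>N\<close> is independent of the generator; it remains to
    see that \<open>x\<close>, \<open>y\<close> are coprime of degree \<open>N\<close> and that x/y
    is weldable.\<close>
  have "minimal_generator weld_field x y N"
  proof
    show "coprime x y" using inn by (simp add: inner_pair_def)
    show "Fract x y \<in> weld_field" unfolding x_def y by (rule G.moebius_mem)
    show "max (degree x) (degree y) = N" using deg degree_reflect[of N x] by (simp add: y_def)
  qed (use G.N G.least in auto)
  then show ?thesis using inn by (rule that)
qed

text \<open>The homogeneous form of \<open>inner_iff\<close>; at a vanishing denominator
  \<open>inner_infinity\<close> decides.\<close>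

lemma norm_form_eval_iff:
  assumes "inner_pair r s" "e = max (degree r) (degree s)" "\<not> (\<xi> = 0 \<and> \<eta> = 0)"
  shows "norm (form_eval e r \<xi> \<eta>) < norm (form_eval e s \<xi> \<eta>) \<longleftrightarrow> norm \<xi> < norm \<eta>"
proof (cases "\<eta> = 0")
  case True
  then show ?thesis
    using inner_infinity[OF assms(1,2)] assms(3) by (auto simp: form_eval_0 norm_mult not_less)
next
  case False
  have "norm (form_eval e r \<xi> \<eta>) < norm (form_eval e s \<xi> \<eta>) \<longleftrightarrow>
      norm (poly r (\<xi> / \<eta>)) < norm (poly s (\<xi> / \<eta>))"
    using False assms(2) by (simp add: form_eval_nz norm_mult)
  also have "\<dots> \<longleftrightarrow> norm (\<xi> / \<eta>) < 1" by (rule inner_iff(1)[OF assms(1)])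
  also have "\<dots> \<longleftrightarrow> norm \<xi> < norm \<eta>" using False by (simp add: norm_divide divide_less_eq_1)
  finally show ?thesis .
qed

text \<open>By \<open>inner_surj\<close> every \<open>c\<close> in the closed disc is a value of
  x/y, taken inside or on the circle according to \<open>c\<close>. The norm comparison for the
  composite at such a point is the one for r/s at \<open>c\<close>.\<close>

lemma inner_pair_left_factor:
  assumes "inner_pair x y" "coprime r s" "e = max (degree r) (degree s)" "e \<ge> 1"
    and "inner_pair (hom_subst e r x y) (hom_subst e s x y)"
  shows "inner_pair r s"
proof -
  have *: "norm (poly r c) < norm (poly s c) \<longleftrightarrow> norm c < 1"
    "norm (poly r c) = norm (poly s c) \<longleftrightarrow> norm c = 1" if c: "norm c \<le> 1" for c
  proof -
    obtain z where z: "poly x z = c * poly y z" "poly y z \<noteq> 0"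
      "norm z < 1 \<longleftrightarrow> norm c < 1" "norm z = 1 \<longleftrightarrow> norm c = 1"
      using inner_surj[OF assms(1) c] .
    have "form_eval e t (poly x z) (poly y z) = poly y z ^ e * poly t c" if "degree t \<le> e" for t
      using that z by (simp add: form_eval_nz)
    then have "poly (hom_subst e r x y) z = poly y z ^ e * poly r c" "poly (hom_subst e s x y) z = poly y z ^ e * poly s c"
      using assms(3) by (auto simp: poly_hom_subst)
    then show "norm (poly r c) < norm (poly s c) \<longleftrightarrow> norm c < 1"
      "norm (poly r c) = norm (poly s c) \<longleftrightarrow> norm c = 1"
      using inner_iff[OF assms(5), of z] z by (auto simp: norm_mult)
  qed
  then show ?thesis using assms(2,3,4) by (simp add: inner_pair_def)
qed

text \<open>With f = r/s, h = x/y and g = v/w, Lueroth's theorem gives p/q = f o h, and p'/q' = f o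
  g because both equal f o h o k on the circle. As f is a Blaschke product, |f(g(z))| < 1 in the
  disc forces |g(z)| < 1, while |g| = 1 on the circle is inherited from h o k.\<close>

lemma welds_factor:
  assumes "minimal_generator weld_field x y N" "inner_pair x y"
    and vw: "coprime v w" "\<And>z. norm z = 1 \<Longrightarrow> poly x (k z) * poly w z = poly v z * poly y (k z)"
    and "welds p q p' q'"
  obtains r s e c where "coprime r s" "e = max (degree r) (degree s)" "e \<ge> 1" "c \<noteq> 0"
    "p = hom_subst e r x y" "q = hom_subst e s x y" "p' = smult c (hom_subst e r v w)" "q' = smult c (hom_subst e s v w)"
    "welds x y v w" "max (degree p) (degree q) = e * N"
proof -
  interpret G: minimal_generator weld_field x y N by fact
  have inn: "inner_pair p q" "inner_pair p' q'"
    and deg: "max (degree p) (degree q) = max (degree p') (degree q')"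
    and weld: "\<And>z. norm z = 1 \<Longrightarrow> poly p (k z) * poly q' z = poly p' z * poly q (k z)"
    using assms(5) by (auto simp: welds_def)
  have cop: "coprime p q" "coprime p' q'" and deg1: "max (degree p) (degree q) \<ge> 1"
    using inn by (auto simp: inner_pair_def)
  obtain r s e where rs: "coprime r s" "e = max (degree r) (degree s)" "p = hom_subst e r x y" "q = hom_subst e s x y"
    using G.lueroth[OF cop(1) welds_mem welds_nz(1)] assms(5) by metis
  have eN: "max (degree p) (degree q) = e * N"
    using max_degree_hom_subst[OF rs(1,2) G.cop G.deg[symmetric]] rs by simp
  have e: "e \<ge> 1" using eN deg1 by (cases e) auto
  have rs_inner: "inner_pair r s"
    using inner_pair_left_factor[OF assms(2) rs(1,2) e] inn(1) rs by simp
  \<comment> \<open>On the circle g = h o k in homogeneous coordinates, with scale factor l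
    depending on z.\<close>
  have scale: "\<exists>l. l \<noteq> 0 \<and> poly v z = l * poly x (k z) \<and> poly w z = l * poly y (k z)"
    if z: "norm z = 1" for z
  proof -
    have "\<not> (poly x (k z) = 0 \<and> poly y (k z) = 0)" using G.cop by (auto simp: coprime_poly_iff)
    then obtain l where "poly v z = l * poly x (k z)" "poly w z = l * poly y (k z)"
      using vw(2)[OF z] by (rule proportional)
    moreover then have "l \<noteq> 0" using vw(1) by (auto simp: coprime_poly_iff)
    ultimately show ?thesis by blast
  qed
  have "hom_subst e r v w * q' = p' * hom_subst e s v w"
  proof (rule poly_eq_on_circle)
    fix z :: complex assume z: "norm z = 1"
    obtain l where l: "poly v z = l * poly x (k z)" "poly w z = l * poly y (k z)"
      using scale[OF z] by blast
    have "poly (hom_subst e r v w) z = l ^ e * poly p (k z)" "poly (hom_subst e s v w) z = l ^ e * poly q (k z)"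
      by (simp_all add: poly_hom_subst l form_eval_scale rs)
    then show "poly (hom_subst e r v w * q') z = poly (p' * hom_subst e s v w) z"
      using weld[OF z] by (simp add: mult_ac)
  qed
  then obtain c where c: "c \<noteq> 0" "p' = smult c (hom_subst e r v w)" "q' = smult c (hom_subst e s v w)"
    using coprime_cross_eq[OF coprime_hom_subst[OF rs(1,2) vw(1)] cop(2)] by metis
  have "max (degree p') (degree q') = e * max (degree v) (degree w)"
    using max_degree_hom_subst[OF rs(1,2) vw(1) refl] c by simp
  then have degN: "max (degree v) (degree w) = N" using eN deg e by simp
  have "inner_pair v w"
    unfolding inner_pair_def
  proof (intro conjI allI impI)
    show "coprime v w" "1 \<le> max (degree v) (degree w)" using vw degN G.N by auto
    fix z :: complex
    show "norm (poly v z) < norm (poly w z)" if z: "norm z < 1"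
    proof -
      have "norm (poly p' z) < norm (poly q' z)" using inn(2) z by (simp add: inner_pair_def)
      then have "norm (form_eval e r (poly v z) (poly w z)) < norm (form_eval e s (poly v z) (poly w z))"
        using c by (simp add: poly_hom_subst norm_mult)
      then show ?thesis
        using norm_form_eval_iff[OF rs_inner rs(2)] vw(1) by (auto simp: coprime_poly_iff)
    qed
    show "norm (poly v z) = norm (poly w z)" if z: "norm z = 1"
    proof -
      have "norm (poly x (k z)) = norm (poly y (k z))"
        using assms(2) k_norm[OF z] by (simp add: inner_pair_def)
      then show ?thesis using scale[OF z] by (auto simp: norm_mult)
    qed
  qed
  then have "welds x y v w" using assms(2) vw(2) degN G.deg by (simp add: welds_def)
  then show ?thesis using that[OF rs(1,2) e c(1) rs(3,4) c(2,3)] eN by blast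
qed

end

section \<open>Composition with Moebius maps on the sphere\<close>

lemma rat_map_smult:
  assumes "c \<noteq> 0"
  shows "rat_map (smult c p) (smult c q) = rat_map p q"
  using assms by (auto simp: rat_map_def fun_eq_iff Let_def split: option.splits)

text \<open>As both pairs have degree \<open>n\<close>, their coefficients at \<open>n\<close> are
  homogeneous coordinates at infinity, and finite and infinite points are treated alike through (u,
  v).\<close>

lemma rat_map_moebius_comp:
  assumes "coprime p q" "max (degree p) (degree q) = n"
    and p': "p' = smult \<alpha> p + smult \<beta> q" and q': "q' = smult \<gamma> p + smult \<delta> q"
    and "max (degree p') (degree q') = n" and det: "\<alpha> * \<delta> - \<beta> * \<gamma> \<noteq> 0"
  shows "rat_map p' q' = rat_map [:\<beta>, \<alpha>:] [:\<delta>, \<gamma>:] \<circ> rat_map p q"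
proof
  fix X
  define u v where "u = (case X of Some z \<Rightarrow> poly p z | None \<Rightarrow> coeff p n)"
    and "v = (case X of Some z \<Rightarrow> poly q z | None \<Rightarrow> coeff q n)"
  have nz: "\<not> (u = 0 \<and> v = 0)"
    using assms(1,2) coeff_max_nz[of p q n]
    by (cases X) (auto simp: u_def v_def coprime_poly_iff)
  \<comment> \<open>The determinant keeps \<open>\<alpha>\<close> and \<open>\<gamma>\<close> from
    both vanishing, so the value of the Moebius map at infinity is read off at index 1.\<close>
  have m1: "max (degree [:\<beta>, \<alpha>:]) (degree [:\<delta>, \<gamma>:]) = 1" using det by auto
  have "rat_map p q X = (if v = 0 then None else Some (u / v))"
    using assms(2) by (auto simp: rat_map_def u_def v_def split: option.splits)
  moreover have "rat_map p' q' X = (if \<gamma> * u + \<delta> * v = 0 then None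
      else Some ((\<alpha> * u + \<beta> * v) / (\<gamma> * u + \<delta> * v)))"
    unfolding rat_map_def assms(5)
    by (cases X) (auto simp: p' q' u_def v_def)
  moreover have "rat_map [:\<beta>, \<alpha>:] [:\<delta>, \<gamma>:] None = (if \<gamma> = 0 then None else Some (\<alpha> / \<gamma>))"
    unfolding rat_map_def m1 by simp
  moreover have "rat_map [:\<beta>, \<alpha>:] [:\<delta>, \<gamma>:] (Some (u / v))
      = (if \<gamma> * u + \<delta> * v = 0 then None else Some ((\<alpha> * u + \<beta> * v) / (\<gamma> * u + \<delta> * v)))"
    if "v \<noteq> 0"
  proof -
    have "poly [:\<delta>, \<gamma>:] (u / v) = (\<gamma> * u + \<delta> * v) / v"
      "poly [:\<beta>, \<alpha>:] (u / v) = (\<alpha> * u + \<beta> * v) / v"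
      using that by (simp_all add: add_divide_distrib)
    moreover have "(if n / v = 0 then None else Some (m / v / (n / v)))
        = (if n = 0 then None else Some (m / n))" for m n
      using that by simp
    ultimately show ?thesis by (simp only: rat_map_Some)
  qed
  ultimately show "rat_map p' q' X = (rat_map [:\<beta>, \<alpha>:] [:\<delta>, \<gamma>:] \<circ> rat_map p q) X"
    using nz by auto
qed

text \<open>A vanishing determinant would make \<open>r\<close> and \<open>s\<close>
  proportional.\<close>

lemma coprime_linear_det:
  fixes r s :: "complex poly"
  assumes "coprime r s" "max (degree r) (degree s) = 1"
  shows "coeff r 1 * coeff s 0 - coeff r 0 * coeff s 1 \<noteq> 0"
proof
  assume det: "coeff r 1 * coeff s 0 - coeff r 0 * coeff s 1 = 0"
  have "coeff (smult (coeff s 1) r) i = coeff (smult (coeff r 1) s) i" for i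
  proof -
    consider "i = 0" | "i = 1" | "i > 1" by linarith
    then show ?thesis
      using det assms(2) by cases (auto simp: coeff_eq_0 mult.commute)
  qed
  then have "smult (coeff s 1) r = smult (coeff r 1) s" by (rule poly_eqI)
  moreover have "coeff s 1 \<noteq> 0 \<or> coeff r 1 \<noteq> 0" using coeff_max_nz[OF assms(1) assms(2)[symmetric]] by auto
  ultimately have "degree r = 0" "degree s = 0" using pencil_dependent_imp_const[OF assms(1)] by auto
  then show False using assms(2) by simp
qed

text \<open>Cramer's rule.\<close>

lemma linear_relation:
  fixes r0 r1 s0 s1 :: complex
  assumes "r1 * s0 - r0 * s1 \<noteq> 0"
  obtains \<alpha> \<beta> where "t1 = \<alpha> * r1 + \<beta> * s1" "t0 = \<alpha> * r0 + \<beta> * s0"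
proof -
  define \<Delta> where "\<Delta> = r1 * s0 - r0 * s1"
  have "\<Delta> \<noteq> 0" using assms by (simp add: \<Delta>_def)
  moreover have "t1 * \<Delta> = (t1 * s0 - t0 * s1) * r1 + (t0 * r1 - t1 * r0) * s1"
    "t0 * \<Delta> = (t1 * s0 - t0 * s1) * r0 + (t0 * r1 - t1 * r0) * s0"
    by (simp_all add: \<Delta>_def algebra_simps)
  ultimately have "t1 = (t1 * s0 - t0 * s1) / \<Delta> * r1 + (t0 * r1 - t1 * r0) / \<Delta> * s1"
    "t0 = (t1 * s0 - t0 * s1) / \<Delta> * r0 + (t0 * r1 - t1 * r0) / \<Delta> * s0"
    by (simp_all add: field_simps)
  then show ?thesis using that by blast
qed

text \<open>The Moebius map carrying r/s to r'/s' by composition on the left depends only on these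
  two. The quantifier over \<open>x\<close>, \<open>y\<close> inside the conclusion lets one map
  serve both components of a solution.\<close>

lemma moebius_change:
  assumes "coprime r s" "max (degree r) (degree s) = 1" "coprime r' s'" "max (degree r') (degree s') = 1"
  obtains \<alpha> \<beta> \<gamma> \<delta> where "\<alpha> * \<delta> - \<beta> * \<gamma> \<noteq> 0"
    "\<And>x y. coprime x y \<Longrightarrow> max (degree x) (degree y) = N \<Longrightarrow>
      rat_map (hom_subst 1 r' x y) (hom_subst 1 s' x y)
        = rat_map [:\<beta>, \<alpha>:] [:\<delta>, \<gamma>:] \<circ> rat_map (hom_subst 1 r x y) (hom_subst 1 s x y)"
proof -
  note det = coprime_linear_det[OF assms(1,2)] and det' = coprime_linear_det[OF assms(3,4)]
  obtain \<alpha> \<beta> where ab: "coeff r' 1 = \<alpha> * coeff r 1 + \<beta> * coeff s 1"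
    "coeff r' 0 = \<alpha> * coeff r 0 + \<beta> * coeff s 0"
    using linear_relation[OF det] by metis
  obtain \<gamma> \<delta> where cd: "coeff s' 1 = \<gamma> * coeff r 1 + \<delta> * coeff s 1"
    "coeff s' 0 = \<gamma> * coeff r 0 + \<delta> * coeff s 0"
    using linear_relation[OF det] by metis
  have "coeff r' 1 * coeff s' 0 - coeff r' 0 * coeff s' 1
      = (\<alpha> * \<delta> - \<beta> * \<gamma>) * (coeff r 1 * coeff s 0 - coeff r 0 * coeff s 1)"
    unfolding ab cd by (simp add: algebra_simps)
  then have d: "\<alpha> * \<delta> - \<beta> * \<gamma> \<noteq> 0" using det' by auto
  show ?thesis
  proof (rule that[OF d])
    fix x y :: "complex poly"
    assume xy: "coprime x y" "max (degree x) (degree y) = N"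
    show "rat_map (hom_subst 1 r' x y) (hom_subst 1 s' x y)
        = rat_map [:\<beta>, \<alpha>:] [:\<delta>, \<gamma>:] \<circ> rat_map (hom_subst 1 r x y) (hom_subst 1 s x y)"
    proof (rule rat_map_moebius_comp[OF coprime_hom_subst _ _ _ _ d])
      show "coprime r s" "1 = max (degree r) (degree s)" "coprime x y"
        using assms xy by auto
      show "max (degree (hom_subst 1 r x y)) (degree (hom_subst 1 s x y)) = N"
        "max (degree (hom_subst 1 r' x y)) (degree (hom_subst 1 s' x y)) = N"
        using max_degree_hom_subst[of r s 1 x y N] max_degree_hom_subst[of r' s' 1 x y N] assms xy by simp_all
      show "hom_subst 1 r' x y = smult \<alpha> (hom_subst 1 r x y) + smult \<beta> (hom_subst 1 s x y)"
        "hom_subst 1 s' x y = smult \<gamma> (hom_subst 1 r x y) + smult \<delta> (hom_subst 1 s x y)"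
        unfolding hom_subst_one ab cd
        by (simp_all add: smult_add_left smult_add_right algebra_simps)
    qed
  qed
qed

theorem corollary1p6:
  fixes k :: "complex \<Rightarrow> complex"
    and A B :: "rsphere \<Rightarrow> rsphere"
    and d :: nat
  assumes "\<exists>k'. homeomorphism (sphere 0 1) (sphere 0 1) k k'"
    and "\<exists>A B. welding_solution k A B"
    and "d = (LEAST n. \<exists>A B. welding_solution k A B \<and> rat_degree A = n)"
    and "welding_solution k A B" and "rat_degree A = d"
  shows "\<forall>A' B'. welding_solution k A' B' \<and> rat_degree A' = d \<longrightarrow>
           (\<exists>M\<in>moebius_disc. A' = M \<circ> A \<and> B' = M \<circ> B)"
proof (intro allI impI, elim conjE)
  fix A' B' assume sol': "welding_solution k A' B'" and deg': "rat_degree A' = d"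
  obtain k' where "homeomorphism (sphere 0 1) (sphere 0 1) k k'" using assms(1) by blast
  then interpret circle_homeomorphism k k' by unfold_locales
  obtain p q p1 q1 where A: "A = rat_map p q" and B: "B = rat_map p1 q1" and w: "welds p q p1 q1"
    using assms(4) by (rule welding_solutionE)
  obtain p' q' p1' q1' where A': "A' = rat_map p' q'" and B': "B' = rat_map p1' q1'"
    and w': "welds p' q' p1' q1'"
    using sol' by (rule welding_solutionE)
  have cop: "coprime p q" "coprime p' q'" using w w' by (auto simp: welds_def inner_pair_def)
  have inn: "inner_pair p q" using w by (simp add: welds_def)
  obtain x y N where gen: "minimal_generator weld_field x y N" and xy: "inner_pair x y"
    using ex_inner_generator[OF inn welds_mem[OF w]] .
  interpret G: minimal_generator weld_field x y N by fact
  \<comment> \<open>The fraction v/u is h o k in lowest terms for the generator h = x/y.\<close>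
  obtain v u where vu: "coprime v u" "\<And>z. norm z = 1 \<Longrightarrow> poly x (k z) * poly u z = poly v z * poly y (k z)"
    using weld_reduced[OF G.cop G.b_nz G.mem] by metis
  obtain r s e c where f: "coprime r s" "e = max (degree r) (degree s)" "e \<ge> 1" "c \<noteq> 0"
    "p = hom_subst e r x y" "q = hom_subst e s x y" "p1 = smult c (hom_subst e r v u)" "q1 = smult c (hom_subst e s v u)"
    "welds x y v u" "max (degree p) (degree q) = e * N"
    using welds_factor[OF gen xy vu w] by metis
  obtain r' s' e' c' where f': "coprime r' s'" "e' = max (degree r') (degree s')" "e' \<ge> 1" "c' \<noteq> 0"
    "p' = hom_subst e' r' x y" "q' = hom_subst e' s' x y" "p1' = smult c' (hom_subst e' r' v u)" "q1' = smult c' (hom_subst e' s' v u)"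
    "max (degree p') (degree q') = e' * N"
    using welds_factor[OF gen xy vu w'] by metis
  \<comment> \<open>The generator and its welded partner form a solution of degree \<open>N\<close>,
    so \<open>d\<close> is at most \<open>N\<close>; since \<open>e * N = d\<close> and
    \<open>e\<close> is positive, both outer factors have degree 1.\<close>
  have "inner_pair v u" using f(9) by (simp add: welds_def)
  then have "welding_solution k (rat_map x y) (rat_map v u)"
    using welding_solution_iff_welds[OF xy] f(9) by blast
  moreover have "rat_degree (rat_map x y) = N" using rat_degree_rat_map[OF G.cop] G.deg by simp
  ultimately have dN: "d \<le> N" unfolding assms(3) by (intro Least_le) blast
  have "e * N = d" "e' * N = d"
    using assms(5) deg' f(10) f'(9) by (simp_all add: A A' rat_degree_rat_map cop)
  with dN f(3) f'(3) G.N have e: "e = 1" "e' = 1"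
    by (metis le_antisym le_square mult.commute mult_cancel2 mult_le_mono1 nat_mult_1 not_one_le_zero)+
  obtain \<alpha> \<beta> \<gamma> \<delta> where M: "\<alpha> * \<delta> - \<beta> * \<gamma> \<noteq> 0"
    "\<And>x y. coprime x y \<Longrightarrow> max (degree x) (degree y) = N \<Longrightarrow>
      rat_map (hom_subst 1 r' x y) (hom_subst 1 s' x y)
        = rat_map [:\<beta>, \<alpha>:] [:\<delta>, \<gamma>:] \<circ> rat_map (hom_subst 1 r x y) (hom_subst 1 s x y)"
    using moebius_change[of r s r' s' N] f(1,2) f'(1,2) e by metis
  define M where "M = rat_map [:\<beta>, \<alpha>:] [:\<delta>, \<gamma>:]"
  have A_eq: "A' = M \<circ> A"
    using M(2)[OF G.cop G.deg] unfolding A A' f(5,6) f'(5,6) e M_def .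
  have "max (degree v) (degree u) = N" using f(9) G.deg by (simp add: welds_def)
  from M(2)[OF vu(1) this] have B_eq: "B' = M \<circ> B"
    unfolding B B' f(7,8) f'(7,8) e M_def by (simp add: rat_map_smult f(4) f'(4))
  \<comment> \<open>Both \<open>A\<close> and \<open>M \<circ> A\<close> map the disc onto itself,
    hence so does \<open>M\<close>.\<close>
  have "A ` disc = disc" "A' ` disc = disc"
    using assms(4) sol' by (auto simp: welding_solution_def blaschke_product_def)
  then have "M ` disc = disc" using A_eq by (metis image_comp)
  then have "M \<in> moebius_disc" using M(1) unfolding moebius_disc_def M_def by blast
  then show "\<exists>M\<in>moebius_disc. A' = M \<circ> A \<and> B' = M \<circ> B" using A_eq B_eq by blast
qed

end
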